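(* Let $\Gamma=(\Omega,I,J,g,q)$ be a finite zero-sum stochastic game. Then any adapted profile $(\sigma_n,\rho_n)_{n\ge 1}$ of $\Gamma$ is asymptotically optimal, i.e. there exists a sequence $\varepsilon_n\to 0$ such that for all $n\ge 1$ the strategies $\sigma_n$ and $\rho_n$ are $\varepsilon_n$-optimal in the $n$-stage game $\Gamma_n$.
   Context: **Stochastic game.** A finite zero-sum stochastic game is a tuple $\Gamma=(\Omega,I,J,g,q)$ with $\Omega$ (states), $I$ (Player 1's actions), $J$ (Player 2's actions) nonempty finite sets, $g:\Omega\times I\times J\to\mathbb{R}$ the payoff function and $q:\Omega\times I\times J\to\Delta(\Omega)$ the transition function, where $\Delta(A)$ is the set of probability distributions on a finite set $A$. From an initial state $\omega_1=\omega$, at each stage $m\ge 1$ the players simultaneously and independently choose $i_m\in I$, $j_m\in J$; the stage payoff is $g_m:=g(\omega_m,i_m,j_m)$ to Player 1 and $-g_m$ to Player 2; $\omega_{m+1}$ is drawn from $q(\omega_m,i_m,j_m)$; players observe $(\omega_{m+1},i_m,j_m)$. **Strategies.** Let $H_m:=(\Omega\times I\times J)^{m-1}\times\Omega$. A strategy of Player 1 is a collection $\sigma=(\sigma_m)_{m\ge1}$ of maps $\sigma_m:H_m\to\Delta(I)$; a strategy of Player 2 is a collection $\rho=(\rho_m)_{m\ge 1}$ of maps $\rho_m:H_m\to\Delta(J)$. The sets of strategies are $\Sigma$ and $T$. A Markov strategy depends only on the current stage and the current state (a map $\mathbb{N}\times\Omega\to\Delta(I)$, resp. $\Delta(J)$);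 a stationary strategy depends only on the current state (a map $x:\Omega\to\Delta(I)$, resp. $y:\Omega\to\Delta(J)$). $\mathbb{E}^\omega_{\sigma,\rho}$ is the expectation for the probability induced on $(\Omega\times I\times J)^{\mathbb{N}}$ by initial state $\omega$ and the pair $(\sigma,\rho)$. **$n$-stage game.** $\gamma_n^\omega(\sigma,\rho)=\mathbb{E}^\omega_{\sigma,\rho}\left(\frac1n\sum_{m=1}^n g_m\right)$, with value $v_n(\omega)=\max_{\sigma\in\Sigma}\min_{\rho\in T}\gamma_n^\omega(\sigma,\rho)=\min_{\rho\in T}\max_{\sigma\in\Sigma}\gamma_n^\omega(\sigma,\rho)$. A strategy $\sigma$ of Player 1 is $\varepsilon$-optimal in $\Gamma_n$ if $\gamma_n^\omega(\sigma,\rho)\ge v_n(\omega)-\varepsilon$ for all $\rho\in T$ and all $\omega\in\Omega$; a strategy $\rho$ of Player 2 is $\varepsilon$-optimal in $\Gamma_n$ if $\gamma_n^\omega(\sigma,\rho)\le v_n(\omega)+\varepsilon$ for all $\sigma\in\Sigma$ and all $\omega\in\Omega$. **$\lambda$-discounted game** ($\lambda\in(0,1]$). $\gamma_\lambda^\omega(\sigma,\rho)=\mathbb{E}^\omega_{\sigma,\rho}\left(\sum_{m\ge1}\lambda(1-\lambda)^{m-1}g_m\right)$, with value $v_\lambda(\omega)=\max_\sigma\min_\rho\gamma_\lambda^\omega(\sigma,\rho)=\min_\rho\max_\sigma\gamma_\lambda^\omega(\sigma,\rho)$. $\sigma$ (resp. $\rho$) is optimal in $\Gamma_\lambda$ if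 for every $\omega$, $\gamma_\lambda^\omega(\sigma,\rho')\ge v_\lambda(\omega)$ for all $\rho'\in T$ (resp. $\gamma_\lambda^\omega(\sigma',\rho)\le v_\lambda(\omega)$ for all $\sigma'\in\Sigma$). **Discounted optimal stationary profile.** A family of pairs of stationary strategies $(x_\lambda,y_\lambda)_{\lambda\in(0,1]}$ such that for each $\lambda\in(0,1]$, $x_\lambda$ and $y_\lambda$ are optimal in $\Gamma_\lambda$. **Adapted profile.** A family of strategy pairs $(\sigma_n,\rho_n)_{n\ge1}$ is an adapted profile if there exist a discounted optimal stationary profile $(x_\lambda,y_\lambda)_\lambda$ and a sequence of positive integers $(a_n)_{n\ge1}$ with $a_n/n\to0$ such that for all $n\ge1$ and every stage $m\in\{1,\dots,n\}$, $\sigma_n$ plays $x_{\lambda^n_{k(m)}}$ and $\rho_n$ plays $y_{\lambda^n_{k(m)}}$ at stage $m$ (i.e. the mixed actions $x_{\lambda^n_{k(m)}}(\omega_m)$ and $y_{\lambda^n_{k(m)}}(\omega_m)$), where $k(m)=\left\lfloor\frac{m-1}{a_n}\right\rfloor$ and $\lambda^n_k=\frac{1}{n-ka_n}$ for integers $k\ge0$ with $ka_n<n$. (An adapted profile is a family of Markov strategy pairs; behaviour after stage $n$ is irrelevant.) *)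

theory Defs
  imports "HOL-Probability.Probability"
begin

text \<open>
  The finite nonempty sets of states, of Player 1's actions and of Player 2's actions are the
  types \<open>'w\<close>, \<open>'i\<close>, \<open>'j\<close>, instantiated to class \<open>finite\<close> in the theorems.  On a finite type,
  \<open>'a pmf\<close> is the simplex of probability distributions.
\<close>

record ('w, 'i, 'j) stochastic_game =
  payoff :: "'w \<Rightarrow> 'i \<Rightarrow> 'j \<Rightarrow> real"
  transition :: "'w \<Rightarrow> 'i \<Rightarrow> 'j \<Rightarrow> 'w pmf"

text \<open>
  A history before stage \<open>m\<close> is a pair of the chronological list of the \<open>m - 1\<close> past triples
  (state, action of Player 1, action of Player 2) and the current state.  The component
  \<open>\<sigma>\<^sub>m\<close> of a strategy is its restriction to lists of length \<open>m - 1\<close>.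
\<close>

type_synonym ('w, 'i, 'j, 'a) strategy = "('w \<times> 'i \<times> 'j) list \<Rightarrow> 'w \<Rightarrow> 'a pmf"

type_synonym ('w, 'i, 'j) strategy1 = "('w, 'i, 'j, 'i) strategy"

type_synonym ('w, 'i, 'j) strategy2 = "('w, 'i, 'j, 'j) strategy"

definition stationary :: "('w \<Rightarrow> 'a pmf) \<Rightarrow> ('w, 'i, 'j, 'a) strategy" where
  "stationary x = (\<lambda>h w. x w)"

text \<open>
  A play is a function \<open>p\<close> on \<open>nat\<close>; stages are numbered from 1, so \<open>p t\<close> is the triple
  \<open>(\<omega>\<^sub>m, i\<^sub>m, j\<^sub>m)\<close> of stage \<open>m = t + 1\<close>.  The kernel below is the law of \<open>p t\<close> given
  \<open>p 0, \<dots>, p (t - 1)\<close>.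
\<close>

definition play_kernel ::
  "('w, 'i, 'j) stochastic_game \<Rightarrow> 'w \<Rightarrow> ('w, 'i, 'j) strategy1 \<Rightarrow> ('w, 'i, 'j) strategy2
    \<Rightarrow> nat \<Rightarrow> (nat \<Rightarrow> 'w \<times> 'i \<times> 'j) \<Rightarrow> ('w \<times> 'i \<times> 'j) pmf" where
  "play_kernel G \<omega> \<sigma> \<rho> t p =
    bind_pmf (if t = 0 then return_pmf \<omega> else (case p (t - 1) of (w, i, j) \<Rightarrow> transition G w i j))
      (\<lambda>w. map_pmf (Pair w) (pair_pmf (\<sigma> (map p [0..<t]) w) (\<rho> (map p [0..<t]) w)))"

text \<open>
  The law of the infinite play: the measure on the product \<open>\<sigma>\<close>-algebra that the Ionescu-Tulcea
  theorem yields for this kernel.  The lemma \<open>Ionescu_Tulcea_play\<close> shows that the theorem applies.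
\<close>

definition play_measure ::
  "('w, 'i, 'j) stochastic_game \<Rightarrow> 'w \<Rightarrow> ('w, 'i, 'j) strategy1 \<Rightarrow> ('w, 'i, 'j) strategy2
    \<Rightarrow> (nat \<Rightarrow> 'w \<times> 'i \<times> 'j) measure" where
  "play_measure G \<omega> \<sigma> \<rho> =
    projective_family.lim UNIV
      (Ionescu_Tulcea.CI (\<lambda>t p. measure_pmf (play_kernel G \<omega> \<sigma> \<rho> t p)) (\<lambda>_. count_space UNIV))
      (\<lambda>_. count_space UNIV)"

lemma Ionescu_Tulcea_play:
  fixes G :: "('w::finite, 'i::finite, 'j::finite) stochastic_game"
  shows "Ionescu_Tulcea (\<lambda>t p. measure_pmf (play_kernel G \<omega> \<sigma> \<rho> t p)) (\<lambda>_. count_space UNIV)"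
proof
  fix t :: nat
  have "PiM {0..<t} (\<lambda>_. count_space (UNIV :: ('w \<times> 'i \<times> 'j) set))
      = count_space (PiE {0..<t} (\<lambda>_. UNIV))"
    by (rule count_space_PiM_finite) auto
  then show "(\<lambda>p. measure_pmf (play_kernel G \<omega> \<sigma> \<rho> t p))
      \<in> PiM {0..<t} (\<lambda>_. count_space UNIV) \<rightarrow>\<^sub>M subprob_algebra (count_space UNIV)"
    by (auto simp: space_subprob_algebra measure_pmf.subprob_space_axioms)
qed

lemma prob_space_play_measure:
  fixes G :: "('w::finite, 'i::finite, 'j::finite) stochastic_game"
  shows "prob_space (play_measure G \<omega> \<sigma> \<rho>)"
proof -
  interpret Ionescu_Tulcea "\<lambda>t p. measure_pmf (play_kernel G \<omega> \<sigma> \<rho> t p)" "\<lambda>_. count_space UNIV"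
    by (rule Ionescu_Tulcea_play)
  have "emeasure PF.lim (PF.emb UNIV {} (space (PiM {} (\<lambda>_. count_space UNIV))))
      = emeasure (CI {}) (space (CI {}))"
    by (subst lim) (auto simp: CI_def)
  moreover have "prob_space (CI {})"
    by (rule PF.prob_space_P) auto
  moreover have "(\<lambda>x. restrict x {}) -` {\<lambda>_. undefined} = (UNIV :: (nat \<Rightarrow> 'w \<times> 'i \<times> 'j) set)"
    by (auto simp: restrict_def)
  ultimately have "emeasure PF.lim (space PF.lim) = 1"
    by (simp add: prod_emb_def space_PiM prob_space.emeasure_space_1)
  then show ?thesis
    unfolding play_measure_def by (rule prob_spaceI)
qed

definition stage_payoff ::
  "('w, 'i, 'j) stochastic_game \<Rightarrow> nat \<Rightarrow> (nat \<Rightarrow> 'w \<times> 'i \<times> 'j) \<Rightarrow> real" where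
  "stage_payoff G m p = (case p (m - 1) of (w, i, j) \<Rightarrow> payoff G w i j)"

definition nstage_payoff ::
  "('w, 'i, 'j) stochastic_game \<Rightarrow> nat \<Rightarrow> 'w \<Rightarrow> ('w, 'i, 'j) strategy1 \<Rightarrow> ('w, 'i, 'j) strategy2
    \<Rightarrow> real" where
  "nstage_payoff G n \<omega> \<sigma> \<rho> =
    (\<integral>p. (1 / real n) * (\<Sum>m = 1..n. stage_payoff G m p) \<partial>play_measure G \<omega> \<sigma> \<rho>)"

text \<open>In the discounted sum the index is \<open>t = m - 1\<close>.\<close>

definition discounted_payoff ::
  "('w, 'i, 'j) stochastic_game \<Rightarrow> real \<Rightarrow> 'w \<Rightarrow> ('w, 'i, 'j) strategy1 \<Rightarrow> ('w, 'i, 'j) strategy2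
    \<Rightarrow> real" where
  "discounted_payoff G l \<omega> \<sigma> \<rho> =
    (\<integral>p. (\<Sum>t. l * (1 - l) ^ t * stage_payoff G (Suc t) p) \<partial>play_measure G \<omega> \<sigma> \<rho>)"

text \<open>
  The values are the max-min values over all behaviour strategies; by the minmax theorem for finite
  games (Shapley's theorem in the discounted case) the supremum and infimum are attained and may be
  exchanged.
\<close>

definition nstage_value :: "('w, 'i, 'j) stochastic_game \<Rightarrow> nat \<Rightarrow> 'w \<Rightarrow> real" where
  "nstage_value G n \<omega> = (SUP \<sigma>. INF \<rho>. nstage_payoff G n \<omega> \<sigma> \<rho>)"

definition discounted_value :: "('w, 'i, 'j) stochastic_game \<Rightarrow> real \<Rightarrow> 'w \<Rightarrow> real" where
  "discounted_value G l \<omega> = (SUP \<sigma>. INF \<rho>. discounted_payoff G l \<omega> \<sigma> \<rho>)"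

definition nstage_eps_optimal1 ::
  "('w, 'i, 'j) stochastic_game \<Rightarrow> nat \<Rightarrow> real \<Rightarrow> ('w, 'i, 'j) strategy1 \<Rightarrow> bool" where
  "nstage_eps_optimal1 G n \<epsilon> \<sigma> \<longleftrightarrow>
    (\<forall>\<rho> \<omega>. nstage_payoff G n \<omega> \<sigma> \<rho> \<ge> nstage_value G n \<omega> - \<epsilon>)"

definition nstage_eps_optimal2 ::
  "('w, 'i, 'j) stochastic_game \<Rightarrow> nat \<Rightarrow> real \<Rightarrow> ('w, 'i, 'j) strategy2 \<Rightarrow> bool" where
  "nstage_eps_optimal2 G n \<epsilon> \<rho> \<longleftrightarrow>
    (\<forall>\<sigma> \<omega>. nstage_payoff G n \<omega> \<sigma> \<rho> \<le> nstage_value G n \<omega> + \<epsilon>)"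

definition discounted_optimal1 ::
  "('w, 'i, 'j) stochastic_game \<Rightarrow> real \<Rightarrow> ('w, 'i, 'j) strategy1 \<Rightarrow> bool" where
  "discounted_optimal1 G l \<sigma> \<longleftrightarrow>
    (\<forall>\<omega> \<rho>. discounted_payoff G l \<omega> \<sigma> \<rho> \<ge> discounted_value G l \<omega>)"

definition discounted_optimal2 ::
  "('w, 'i, 'j) stochastic_game \<Rightarrow> real \<Rightarrow> ('w, 'i, 'j) strategy2 \<Rightarrow> bool" where
  "discounted_optimal2 G l \<rho> \<longleftrightarrow>
    (\<forall>\<omega> \<sigma>. discounted_payoff G l \<omega> \<sigma> \<rho> \<le> discounted_value G l \<omega>)"

definition discounted_optimal_stationary_profile ::
  "('w, 'i, 'j) stochastic_game \<Rightarrow> (real \<Rightarrow> 'w \<Rightarrow> 'i pmf) \<Rightarrow> (real \<Rightarrow> 'w \<Rightarrow> 'j pmf) \<Rightarrow> bool" where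
  "discounted_optimal_stationary_profile G x y \<longleftrightarrow>
    (\<forall>l\<in>{0<..1}. discounted_optimal1 G l (stationary (x l)) \<and>
                 discounted_optimal2 G l (stationary (y l)))"

text \<open>The discount factor \<open>\<lambda>\<^sup>n\<^sub>k\<close> for block length \<open>a = a\<^sub>n\<close>, used only when \<open>k * a < n\<close>.\<close>

definition block_discount :: "nat \<Rightarrow> nat \<Rightarrow> nat \<Rightarrow> real" where
  "block_discount a n k = 1 / (real n - real k * real a)"

text \<open>
  The conditions constrain \<open>\<sigma> n\<close> and \<open>\<rho> n\<close> at every history of the stages \<open>1, \<dots>, n\<close>, and
  not at all after stage \<open>n\<close>.
\<close>

definition adapted_profile ::
  "('w, 'i, 'j) stochastic_game \<Rightarrow> (nat \<Rightarrow> ('w, 'i, 'j) strategy1) \<Rightarrow> (nat \<Rightarrow> ('w, 'i, 'j) strategy2)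
    \<Rightarrow> bool" where
  "adapted_profile G \<sigma> \<rho> \<longleftrightarrow>
    (\<exists>x y. \<exists>a :: nat \<Rightarrow> nat.
      discounted_optimal_stationary_profile G x y \<and>
      (\<forall>n\<ge>1. a n > 0) \<and>
      (\<lambda>n. real (a n) / real n) \<longlonglongrightarrow> 0 \<and>
      (\<forall>n\<ge>1. \<forall>m\<in>{1..n}. \<forall>h w. length h = m - 1 \<longrightarrow>
         \<sigma> n h w = x (block_discount (a n) n ((m - 1) div a n)) w \<and>
         \<rho> n h w = y (block_discount (a n) n ((m - 1) div a n)) w))"

end

theory Submission
  imports Defs
begin

text \<open>
  For a discount factor \<open>\<lambda> = 1 / L\<close> the Shapley equation says that a player using \<open>x\<^sub>\<lambda>\<close> guarantees
  \<open>g\<^sub>m + (L - 1) v\<^sub>\<lambda>(\<omega>\<^sub>m\<^sub>+\<^sub>1) \<ge> L v\<^sub>\<lambda>(\<omega>\<^sub>m)\<close> in expectation.  With the potential (number of remaining stages) times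
  (current value of the state), these inequalities telescope along the \<open>n\<close> stages: since the expected
  value is almost nondecreasing, the part of the error due to the constant discount factor inside a
  block also telescopes and is of order \<open>a\<^sub>n + sqrt (n a\<^sub>n)\<close>.  What remains is
  \<open>\<Sum>\<^sub>k L\<^sub>k\<^sub>+\<^sub>1 \<parallel>v\<^sub>k - v\<^sub>k\<^sub>+\<^sub>1\<parallel>\<close>, which is \<open>o(n)\<close> because \<open>\<lambda> \<mapsto> v\<^sub>\<lambda>\<close> has bounded variation and a limit at 0.
  Both players thus guarantee \<open>v\<^sub>1\<^sub>/\<^sub>n\<close> up to \<open>o(1)\<close> in the \<open>n\<close>-stage game.

  The bounded variation is obtained without semialgebraic geometry.  By Cramer's rule the discounted
  payoff of stationary strategies is a quotient of determinants that are multilinear in the mixed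
  actions.  Hence \<open>v\<^sub>\<lambda>(\<omega>) > c\<close> holds iff a system of strict linear inequalities, whose coefficients are
  polynomials in \<open>\<lambda>\<close>, is solvable (following Attia and Oliu-Barton).  Fourier-Motzkin elimination
  shows that the solvability switches at most \<open>N\<close> times as \<open>\<lambda>\<close> varies, with \<open>N\<close> independent of \<open>c\<close>;
  integrating the number of crossings of the level \<open>c\<close> over \<open>c\<close> bounds the variation.
\<close>

subsection \<open>Linear systems with polynomial coefficients\<close>

text \<open>Encoded by a finite exceptional set instead of a count of changes: an isolated truth
  value costs a single point of \<open>F\<close>, and unions of such sets serve for combined
  predicates.\<close>

definition switches_at_most :: "nat \<Rightarrow> real set \<Rightarrow> (real \<Rightarrow> bool) \<Rightarrow> bool" where
  "switches_at_most N D P \<longleftrightarrow>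
    (\<exists>F. finite F \<and> card F \<le> N \<and>
      (\<forall>a\<in>D. \<forall>b\<in>D. a \<le> b \<longrightarrow> {a..b} \<inter> F = {} \<longrightarrow> P a = P b))"

lemma sgn_poly_eq_if_no_root:
  fixes p :: "real poly"
  assumes "a \<le> b" "\<And>x. a \<le> x \<Longrightarrow> x \<le> b \<Longrightarrow> poly p x \<noteq> 0"
  shows "sgn (poly p a) = sgn (poly p b)"
proof (cases "a = b")
  case False
  then have "a < b" using assms by simp
  have "poly p a \<noteq> 0" "poly p b \<noteq> 0" using assms by auto
  then show ?thesis
    using poly_IVT_pos[OF \<open>a < b\<close>, of p] poly_IVT_neg[OF \<open>a < b\<close>, of p] assms(2)
    by (smt (verit) sgn_1_neg sgn_1_pos)
qed simp

text \<open>Rows with \<open>\<alpha> r > 0\<close> are lower bounds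
  \<open>- \<beta> r / \<alpha> r\<close> on \<open>t\<close>, rows with
  \<open>\<alpha> r < 0\<close> upper bounds; by finiteness it is enough that each lower bound lies
  below each upper one. The comparison is cross-multiplied so that it stays polynomial in the
  coefficients.\<close>

lemma ex_strict_linear_iff:
  fixes \<alpha> \<beta> :: "'r \<Rightarrow> real"
  assumes "finite S"
  shows "(\<exists>t. \<forall>r\<in>S. \<alpha> r * t + \<beta> r > 0) \<longleftrightarrow>
    (\<forall>r\<in>S. \<alpha> r = 0 \<longrightarrow> \<beta> r > 0) \<and>
    (\<forall>p\<in>S. \<forall>n\<in>S. \<alpha> p > 0 \<longrightarrow> \<alpha> n < 0 \<longrightarrow> \<alpha> p * \<beta> n - \<alpha> n * \<beta> p > 0)"
    (is "?L \<longleftrightarrow> ?R")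
proof
  assume ?L
  then obtain t where t: "\<And>r. r \<in> S \<Longrightarrow> \<alpha> r * t + \<beta> r > 0" by blast
  show ?R
  proof (intro conjI ballI impI)
    fix r assume "r \<in> S" "\<alpha> r = 0"
    then show "\<beta> r > 0" using t[of r] by simp
  next
    fix p n assume *: "p \<in> S" "n \<in> S" "\<alpha> p > 0" "\<alpha> n < 0"
    have "\<alpha> p * (\<alpha> n * t + \<beta> n) > 0"
      by (rule mult_pos_pos[OF *(3) t[OF *(2)]])
    moreover have "(- \<alpha> n) * (\<alpha> p * t + \<beta> p) > 0"
      using *(4) by (intro mult_pos_pos t[OF *(1)]) simp
    ultimately have "\<alpha> p * (\<alpha> n * t + \<beta> n) + (- \<alpha> n) * (\<alpha> p * t + \<beta> p) > 0"
      by linarith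
    then show "\<alpha> p * \<beta> n - \<alpha> n * \<beta> p > 0" by (simp add: algebra_simps)
  qed
next
  assume R: ?R
  define Lo where "Lo = (\<lambda>r. - \<beta> r / \<alpha> r) ` {r \<in> S. \<alpha> r > 0}"
  define Up where "Up = (\<lambda>r. - \<beta> r / \<alpha> r) ` {r \<in> S. \<alpha> r < 0}"
  have fin: "finite Lo" "finite Up" using assms by (auto simp: Lo_def Up_def)
  have lt: "l < u" if lu: "l \<in> Lo" "u \<in> Up" for l u
  proof -
    from lu obtain p n where pn: "p \<in> S" "\<alpha> p > 0" "l = - \<beta> p / \<alpha> p"
      "n \<in> S" "\<alpha> n < 0" "u = - \<beta> n / \<alpha> n" by (auto simp: Lo_def Up_def)
    then have "\<alpha> p * \<beta> n - \<alpha> n * \<beta> p > 0" using R by blast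
    moreover have "\<alpha> p * \<alpha> n < 0" using pn by (simp add: mult_pos_neg)
    moreover have "l - u = (\<alpha> p * \<beta> n - \<alpha> n * \<beta> p) / (\<alpha> p * \<alpha> n)"
      unfolding pn(3,6) using pn(2,5) by (simp add: field_simps)
    ultimately have "l - u < 0" by (simp add: divide_pos_neg)
    then show ?thesis by simp
  qed
  have "\<exists>t. (\<forall>l\<in>Lo. l < t) \<and> (\<forall>u\<in>Up. t < u)"
  proof -
    consider "Lo = {}" "Up = {}" | "Lo = {}" "Up \<noteq> {}" | "Lo \<noteq> {}" "Up = {}" | "Lo \<noteq> {}" "Up \<noteq> {}"
      by blast
    then show ?thesis
    proof cases
      case 2
      have "Min Up - 1 < u" if "u \<in> Up" for u using Min_le[OF fin(2) that] by linarith
      then show ?thesis using 2 by blast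
    next
      case 3
      have "u < Max Lo + 1" if "u \<in> Lo" for u using Max_ge[OF fin(1) that] by linarith
      then show ?thesis using 3 by blast
    next
      case 4
      then have "Max Lo < Min Up" using lt fin by simp
      then obtain t where "Max Lo < t" "t < Min Up" using dense by blast
      then show ?thesis using fin 4 by (intro exI[of _ t]) auto
    qed auto
  qed
  then obtain t where t: "\<forall>l\<in>Lo. l < t" "\<forall>u\<in>Up. t < u" by blast
  have "\<alpha> r * t + \<beta> r > 0" if "r \<in> S" for r
  proof (cases "\<alpha> r" "0::real" rule: linorder_cases)
    case less
    then have "t < - \<beta> r / \<alpha> r" using t that by (auto simp: Up_def)
    then show ?thesis using less by (simp add: field_simps)
  next
    case equal
    then show ?thesis using R that by simp
  next
    case greater
    then have "- \<beta> r / \<alpha> r < t" using t that by (auto simp: Lo_def)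
    then show ?thesis using greater by (simp add: field_simps)
  qed
  then show ?L by blast
qed

definition feasible :: "'v set \<Rightarrow> ('v \<Rightarrow> real poly) set \<Rightarrow> real \<Rightarrow> bool" where
  "feasible K S l \<longleftrightarrow> (\<exists>X. \<forall>r\<in>S. (\<Sum>v\<in>K. poly (r v) l * X v) > 0)"

text \<open>One Fourier-Motzkin step. The sign classes \<open>P\<close>, \<open>Q\<close>,
  \<open>Z\<close> of the coefficient of \<open>v\<close> are arguments, not read off at a parameter
  value, so that for fixed classes the result is one system with polynomial coefficients.\<close>

definition eliminate ::
  "'v \<Rightarrow> ('v \<Rightarrow> real poly) set \<Rightarrow> ('v \<Rightarrow> real poly) set \<Rightarrow> ('v \<Rightarrow> real poly) set
    \<Rightarrow> ('v \<Rightarrow> real poly) set" where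
  "eliminate v P Q Z = Z \<union> (\<lambda>(p, n) u. p v * n u - n v * p u) ` (P \<times> Q)"

lemma feasible_insert:
  assumes "finite K" "v \<notin> K" "finite S"
  shows "feasible (insert v K) S l \<longleftrightarrow>
    feasible K (eliminate v {r\<in>S. poly (r v) l > 0} {r\<in>S. poly (r v) l < 0}
      {r\<in>S. poly (r v) l = 0}) l"
proof -
  define \<beta> where "\<beta> X r = (\<Sum>u\<in>K. poly (r u) l * X u)" for X :: "'a \<Rightarrow> real" and r
  have comb: "\<beta> X (\<lambda>u. p v * n u - n v * p u)
      = poly (p v) l * \<beta> X n - poly (n v) l * \<beta> X p" for p n X
    by (simp add: \<beta>_def sum_distrib_left sum_subtractf algebra_simps)
  have "feasible (insert v K) S l \<longleftrightarrow> (\<exists>X t. \<forall>r\<in>S. poly (r v) l * t + \<beta> X r > 0)"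
  proof
    assume "feasible (insert v K) S l"
    then obtain X where "\<forall>r\<in>S. (\<Sum>u\<in>insert v K. poly (r u) l * X u) > 0"
      unfolding feasible_def by blast
    then show "\<exists>X t. \<forall>r\<in>S. poly (r v) l * t + \<beta> X r > 0"
      using assms by (intro exI[of _ X] exI[of _ "X v"]) (simp add: \<beta>_def)
  next
    assume "\<exists>X t. \<forall>r\<in>S. poly (r v) l * t + \<beta> X r > 0"
    then obtain X t where X: "\<forall>r\<in>S. poly (r v) l * t + \<beta> X r > 0" by blast
    have "(\<Sum>u\<in>K. poly (r u) l * (X(v := t)) u) = \<beta> X r" for r
      unfolding \<beta>_def using assms by (intro sum.cong) auto
    then show "feasible (insert v K) S l"
      unfolding feasible_def using X assms by (intro exI[of _ "X(v := t)"]) simp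
  qed
  also have "\<dots> \<longleftrightarrow> (\<exists>X. (\<forall>r\<in>S. poly (r v) l = 0 \<longrightarrow> \<beta> X r > 0) \<and>
    (\<forall>p\<in>S. \<forall>n\<in>S. poly (p v) l > 0 \<longrightarrow> poly (n v) l < 0 \<longrightarrow>
      poly (p v) l * \<beta> X n - poly (n v) l * \<beta> X p > 0))"
    by (subst ex_strict_linear_iff[OF assms(3)]) simp
  also have "\<dots> \<longleftrightarrow> feasible K (eliminate v {r\<in>S. poly (r v) l > 0} {r\<in>S. poly (r v) l < 0}
      {r\<in>S. poly (r v) l = 0}) l"
    unfolding feasible_def eliminate_def \<beta>_def[symmetric]
    by (intro arg_cong[where f = Ex] ext) (simp only: ball_Un, auto simp: comb)
  finally show ?thesis .
qed

text \<open>Between roots of the coefficients of \<open>v\<close> the sign classes are constant, so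
  solvability is that of one fixed eliminated system, to which the induction hypothesis applies. The
  induction generalizes \<open>m\<close> and \<open>d\<close>, since elimination yields up to
  \<open>m + m * m\<close> rows of degree up to \<open>d + d\<close>.\<close>

lemma feasible_switches:
  fixes K :: "'v set"
  assumes "finite K"
  shows "\<exists>N. \<forall>S. finite S \<and> card S \<le> m \<and> (\<forall>r\<in>S. \<forall>v\<in>K. degree (r v) \<le> d) \<longrightarrow>
    switches_at_most N UNIV (feasible K S)"
  using assms
proof (induction K arbitrary: m d)
  case empty
  \<comment> \<open>Without unknowns every row reads \<open>0 > 0\<close>, whatever the
    parameter.\<close>
  have "feasible {} S = (\<lambda>_. S = {})" for S :: "('v \<Rightarrow> real poly) set"
    by (auto simp: feasible_def fun_eq_iff)
  then show ?case
    by (auto simp: switches_at_most_def intro!: exI[of _ "{} :: real set"])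
next
  case (insert v K)
  obtain N where N: "\<And>S. finite S \<Longrightarrow> card S \<le> m + m * m \<Longrightarrow>
      (\<forall>r\<in>S. \<forall>v\<in>K. degree (r v) \<le> d + d) \<Longrightarrow> switches_at_most N UNIV (feasible K S)"
    using insert.IH[of "m + m * m" "d + d"] by blast
  show ?case
  proof (intro exI[of _ "m * d + 2 ^ m * 2 ^ m * 2 ^ m * N"] allI impI)
    fix S :: "('v \<Rightarrow> real poly) set"
    assume S: "finite S \<and> card S \<le> m \<and> (\<forall>r\<in>S. \<forall>v\<in>insert v K. degree (r v) \<le> d)"
    \<comment> \<open>All conceivable triples of sign classes; the switching points of their
      eliminated systems are collected in advance, whichever triples occur.\<close>
    define C where "C = Pow S \<times> Pow S \<times> Pow S"
    have finC: "finite C" using S by (simp add: C_def)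
    have "switches_at_most N UNIV (feasible K (eliminate v P Q Z))" if "(P, Q, Z) \<in> C" for P Q Z
    proof (rule N)
      have sub: "P \<subseteq> S" "Q \<subseteq> S" "Z \<subseteq> S" using that by (auto simp: C_def)
      then have fin: "finite P" "finite Q" "finite Z" using S finite_subset by auto
      have cards: "card P \<le> m" "card Q \<le> m" "card Z \<le> m"
        using sub S by (meson card_mono le_trans)+
      show "finite (eliminate v P Q Z)" using fin by (auto simp: eliminate_def)
      have "card (eliminate v P Q Z) \<le> card Z + card (P \<times> Q)"
        unfolding eliminate_def using fin
        by (intro order.trans[OF card_Un_le] add_left_mono card_image_le) auto
      also have "\<dots> \<le> m + m * m"
        using cards by (auto simp: card_cartesian_product intro!: add_mono mult_mono)
      finally show "card (eliminate v P Q Z) \<le> m + m * m" .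
      have deg: "degree (r u) \<le> d" if "r \<in> S" "u \<in> insert v K" for r u using S that by blast
      have "degree (p v * n u - n v * p u) \<le> d + d" if "p \<in> P" "n \<in> Q" "u \<in> K" for p n u
      proof (rule degree_diff_le)
        show "degree (p v * n u) \<le> d + d"
          using that sub by (intro order.trans[OF degree_mult_le] add_mono deg) auto
        show "degree (n v * p u) \<le> d + d"
          using that sub by (intro order.trans[OF degree_mult_le] add_mono deg) auto
      qed
      moreover have "degree (r u) \<le> d + d" if "r \<in> Z" "u \<in> K" for r u
        using deg[of r u] that sub by auto
      ultimately show "\<forall>r\<in>eliminate v P Q Z. \<forall>u\<in>K. degree (r u) \<le> d + d"
        by (auto simp: eliminate_def)
    qed
    then have "\<forall>c\<in>C. \<exists>F. finite F \<and> card F \<le> N \<and> (\<forall>a b. a \<le> b \<longrightarrow> {a..b} \<inter> F = {} \<longrightarrow>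
        (case c of (P, Q, Z) \<Rightarrow> feasible K (eliminate v P Q Z) a = feasible K (eliminate v P Q Z) b))"
      by (auto simp: switches_at_most_def)
    then obtain F where F: "\<And>c. c \<in> C \<Longrightarrow> finite (F c)" "\<And>c. c \<in> C \<Longrightarrow> card (F c) \<le> N"
      "\<And>P Q Z a b. (P, Q, Z) \<in> C \<Longrightarrow> a \<le> b \<Longrightarrow> {a..b} \<inter> F (P, Q, Z) = {} \<Longrightarrow>
        feasible K (eliminate v P Q Z) a = feasible K (eliminate v P Q Z) b"
      unfolding bchoice_iff by (metis (mono_tags, lifting) case_prod_conv)
    \<comment> \<open>Rows with \<open>r v = 0\<close> are left out: the zero polynomial has
      infinitely many roots but constant sign.\<close>
    define R where "R = (\<Union>r\<in>{r\<in>S. r v \<noteq> 0}. {x. poly (r v) x = 0})"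
    have "finite R" using S poly_roots_finite by (auto simp: R_def)
    have "card R \<le> (\<Sum>r\<in>{r\<in>S. r v \<noteq> 0}. card {x. poly (r v) x = 0})"
      unfolding R_def using S by (intro card_UN_le) auto
    also have "\<dots> \<le> (\<Sum>r\<in>{r\<in>S. r v \<noteq> 0}. d)"
      using S by (intro sum_mono order.trans[OF card_poly_roots_bound]) auto
    also have "\<dots> \<le> m * d"
      using S card_mono[of S "{r\<in>S. r v \<noteq> 0}"] by (auto intro!: mult_right_mono)
    finally have cardR: "card R \<le> m * d" .
    define FF where "FF = R \<union> (\<Union>c\<in>C. F c)"
    have "card (\<Union>c\<in>C. F c) \<le> (\<Sum>c\<in>C. N)"
      by (intro order.trans[OF card_UN_le] sum_mono F finC)
    also have "\<dots> = 2 ^ card S * 2 ^ card S * 2 ^ card S * N"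
      using S by (simp add: C_def card_cartesian_product card_Pow)
    also have "\<dots> \<le> 2 ^ m * 2 ^ m * 2 ^ m * N"
      using S by (intro mult_mono power_increasing) auto
    finally have "card FF \<le> m * d + 2 ^ m * 2 ^ m * 2 ^ m * N"
      unfolding FF_def using cardR by (intro order.trans[OF card_Un_le] add_mono)
    moreover have "finite FF" using \<open>finite R\<close> F(1) finC by (auto simp: FF_def)
    moreover have "feasible (insert v K) S a = feasible (insert v K) S b"
      if ab: "a \<le> b" "{a..b} \<inter> FF = {}" for a b
    proof -
      have sgn: "sgn (poly (r v) a) = sgn (poly (r v) b)" if "r \<in> S" for r
      proof (cases "r v = 0")
        case False
        then have "poly (r v) x \<noteq> 0" if "a \<le> x" "x \<le> b" for x
          using ab that \<open>r \<in> S\<close> by (auto simp: FF_def R_def disjoint_iff)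
        then show ?thesis using ab(1) by (intro sgn_poly_eq_if_no_root)
      qed simp
      define P Q Z where "P = {r\<in>S. poly (r v) a > 0}" and "Q = {r\<in>S. poly (r v) a < 0}"
        and "Z = {r\<in>S. poly (r v) a = 0}"
      have b: "P = {r\<in>S. poly (r v) b > 0}" "Q = {r\<in>S. poly (r v) b < 0}"
        "Z = {r\<in>S. poly (r v) b = 0}"
        unfolding P_def Q_def Z_def using sgn by (auto simp: sgn_1_pos sgn_1_neg sgn_zero_iff)
          (metis sgn_1_pos sgn_1_neg sgn_zero_iff)+
      have C: "(P, Q, Z) \<in> C" by (auto simp: C_def P_def Q_def Z_def)
      have "feasible (insert v K) S a = feasible K (eliminate v P Q Z) a"
        unfolding P_def Q_def Z_def using insert S by (intro feasible_insert) auto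
      also have "\<dots> = feasible K (eliminate v P Q Z) b"
        using ab C by (intro F(3)) (auto simp: FF_def)
      also have "\<dots> = feasible (insert v K) S b"
        unfolding b using insert S by (intro feasible_insert[symmetric]) auto
      finally show ?thesis .
    qed
    ultimately show "switches_at_most (m * d + 2 ^ m * 2 ^ m * 2 ^ m * N) UNIV
        (feasible (insert v K) S)"
      unfolding switches_at_most_def by (intro exI[of _ FF]) blast
  qed
qed

section \<open>Level crossings, total variation and behaviour near 0\<close>

lemma switches_at_mostE:
  assumes "switches_at_most N D P"
  obtains F where "finite F" "card F \<le> N"
    "\<And>a b. a \<in> D \<Longrightarrow> b \<in> D \<Longrightarrow> a \<le> b \<Longrightarrow> {a..b} \<inter> F = {} \<Longrightarrow> P a = P b"
proof -
  from assms obtain F where F: "finite F \<and> card F \<le> N \<and>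
      (\<forall>a\<in>D. \<forall>b\<in>D. a \<le> b \<longrightarrow> {a..b} \<inter> F = {} \<longrightarrow> P a = P b)"
    unfolding switches_at_most_def by (elim exE)
  show thesis
    by (rule that[of F]) (use F in simp_all)
qed

text \<open>A change of \<open>P\<close> is paid for by a point of \<open>F\<close> in the closed
  interval between the two arguments, and intervals with different indices share at most an
  endpoint.\<close>

lemma sum_crossings_le:
  fixes \<mu> :: "nat \<Rightarrow> real"
  assumes S: "finite S" and D: "\<And>k. k \<in> S \<Longrightarrow> \<mu> k \<in> D \<and> \<mu> (Suc k) \<in> D"
    and mono: "\<And>k. k \<in> S \<Longrightarrow> \<mu> k < \<mu> (Suc k)"
    and sep: "\<And>j k. j \<in> S \<Longrightarrow> k \<in> S \<Longrightarrow> j < k \<Longrightarrow> \<mu> (Suc j) \<le> \<mu> k"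
    and P: "switches_at_most N D P"
  shows "card {k\<in>S. P (\<mu> k) \<noteq> P (\<mu> (Suc k))} \<le> 2 * N"
proof -
  obtain F where F: "finite F" "card F \<le> N"
    "\<And>a b. a \<in> D \<Longrightarrow> b \<in> D \<Longrightarrow> a \<le> b \<Longrightarrow> {a..b} \<inter> F = {} \<Longrightarrow> P a = P b"
    using P by (rule switches_at_mostE) (rule that)
  define T where "T = {k\<in>S. P (\<mu> k) \<noteq> P (\<mu> (Suc k))}"
  have "\<exists>z. z \<in> F \<and> \<mu> k \<le> z \<and> z \<le> \<mu> (Suc k)" if "k \<in> T" for k
    using F(3)[of "\<mu> k" "\<mu> (Suc k)"] D[of k] mono[of k] that by (force simp: T_def)
  then obtain z where z: "\<And>k. k \<in> T \<Longrightarrow> z k \<in> F \<and> \<mu> k \<le> z k \<and> z k \<le> \<mu> (Suc k)"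
    by metis
  \<comment> \<open>A point of \<open>F\<close> may be an endpoint of two of the intervals, hence the factor 2.\<close>
  have "inj_on (\<lambda>k. (z k, z k = \<mu> k)) T"
  proof (rule linorder_inj_onI')
    fix j k assume jk: "j \<in> T" "k \<in> T" "j < k"
    then have "\<mu> (Suc j) \<le> \<mu> k" "\<mu> j < \<mu> (Suc j)" using sep mono by (auto simp: T_def)
    with z[OF jk(1)] z[OF jk(2)] show "(z j, z j = \<mu> j) \<noteq> (z k, z k = \<mu> k)" by auto
  qed
  then have "card T \<le> card (F \<times> (UNIV :: bool set))"
    using z F(1) by (intro card_inj_on_le[where f = "\<lambda>k. (z k, z k = \<mu> k)"]) auto
  then show ?thesis using F(2) by (simp add: card_cartesian_product T_def)
qed

text \<open>Banach's indicatrix: each absolute difference is the measure of the levels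
  \<open>c\<close> separating the two values. Hence the sum is the integral over \<open>c\<close> of
  the number of crossings of \<open>c\<close>, which is at most \<open>2 * N\<close> and vanishes
  outside \<open>{lo..hi}\<close>.\<close>

lemma sum_abs_diff_le:
  fixes \<mu> :: "nat \<Rightarrow> real" and f :: "real \<Rightarrow> real"
  assumes S: "finite S" and D: "\<And>k. k \<in> S \<Longrightarrow> \<mu> k \<in> D \<and> \<mu> (Suc k) \<in> D"
    and mono: "\<And>k. k \<in> S \<Longrightarrow> \<mu> k < \<mu> (Suc k)"
    and sep: "\<And>j k. j \<in> S \<Longrightarrow> k \<in> S \<Longrightarrow> j < k \<Longrightarrow> \<mu> (Suc j) \<le> \<mu> k"
    and f: "\<And>c. switches_at_most N D (\<lambda>l. f l > c)"
    and range: "\<And>k. k \<in> S \<Longrightarrow> f (\<mu> k) \<in> {lo..hi} \<and> f (\<mu> (Suc k)) \<in> {lo..hi}"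
    and "lo \<le> hi"
  shows "(\<Sum>k\<in>S. \<bar>f (\<mu> (Suc k)) - f (\<mu> k)\<bar>) \<le> 2 * real N * (hi - lo)"
proof -
  \<comment> \<open>Half-open, so that \<open>c \<in> I k\<close> says that exactly one of the two
    values is strictly above \<open>c\<close>.\<close>
  define I where "I k = {min (f (\<mu> k)) (f (\<mu> (Suc k))) ..< max (f (\<mu> k)) (f (\<mu> (Suc k)))}" for k
  have I: "c \<in> I k \<longleftrightarrow> (f (\<mu> k) > c) \<noteq> (f (\<mu> (Suc k)) > c)" for c k
    by (auto simp: I_def min_def max_def)
  have sub: "I k \<subseteq> {lo..hi}" if "k \<in> S" for k
    using range[OF that] by (auto simp: I_def)
  have meas: "measure lborel (I k) = \<bar>f (\<mu> (Suc k)) - f (\<mu> k)\<bar>" for k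
    by (auto simp: I_def min_def max_def)
  have int: "integrable lborel (indicator (I k) :: real \<Rightarrow> real)" for k
    by (auto simp: I_def intro!: integrable_real_indicator)
  have "(\<Sum>k\<in>S. \<bar>f (\<mu> (Suc k)) - f (\<mu> k)\<bar>) = (\<Sum>k\<in>S. \<integral>c. indicator (I k) c \<partial>lborel)"
    by (simp add: meas)
  also have "\<dots> = (\<integral>c. (\<Sum>k\<in>S. indicator (I k) c) \<partial>lborel)"
    using int by (subst Bochner_Integration.integral_sum) auto
  also have "\<dots> \<le> (\<integral>c. 2 * real N * indicator {lo..hi} c \<partial>lborel)"
  proof (rule integral_mono)
    show "integrable lborel (\<lambda>c. \<Sum>k\<in>S. indicator (I k) c :: real)"
      using int by (intro Bochner_Integration.integrable_sum) auto
    show "integrable lborel (\<lambda>c. 2 * real N * indicator {lo..hi} c)"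
      by (intro integrable_mult_right integrable_real_indicator) (simp_all add: emeasure_lborel_Icc_eq)
    fix c :: real
    have eq: "(\<Sum>k\<in>S. indicator (I k) c) = real (card {k\<in>S. c \<in> I k})"
      using S by (simp add: indicator_def sum.If_cases Int_def)
    have "card {k\<in>S. c \<in> I k} \<le> 2 * N"
      unfolding I by (rule sum_crossings_le[where D = D and P = "\<lambda>l. f l > c"])
        (use S D mono sep f in simp_all)
    then have "real (card {k\<in>S. c \<in> I k}) \<le> 2 * real N" by linarith
    moreover have "card {k\<in>S. c \<in> I k} = 0" if "c \<notin> {lo..hi}"
    proof -
      have "{k\<in>S. c \<in> I k} = {}" using that sub by blast
      then show ?thesis by (simp only: card.empty)
    qed
    ultimately show "(\<Sum>k\<in>S. indicator (I k) c) \<le> 2 * real N * indicator {lo..hi} c"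
      unfolding eq by (cases "c \<in> {lo..hi}") simp_all
  qed
  also have "\<dots> = 2 * real N * (hi - lo)" using \<open>lo \<le> hi\<close> by simp
  finally show ?thesis .
qed

text \<open>Near 0, \<open>f\<close> is either always above a given level or never. The supremum
  \<open>s\<close> of the levels of the first kind is the limit of \<open>f\<close> at 0, and the
  window is centred at \<open>s\<close>.\<close>

lemma switches_convergent:
  fixes f :: "real \<Rightarrow> real"
  assumes f: "\<And>c. switches_at_most N {0<..1} (\<lambda>l. f l > c)"
    and bound: "\<And>l. l \<in> {0<..1} \<Longrightarrow> \<bar>f l\<bar> \<le> C"
    and "\<eta> > 0"
  shows "\<exists>\<delta> lo. 0 < \<delta> \<and> \<delta> \<le> 1 \<and> (\<forall>l\<in>{0<..\<delta>}. f l \<in> {lo..lo + \<eta>})"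
proof -
  have ev: "\<exists>\<delta>\<in>{0<..1}. (\<forall>l\<in>{0<..\<delta>}. f l > c) \<or> (\<forall>l\<in>{0<..\<delta>}. f l \<le> c)" for c
  proof -
    obtain F where F: "finite F"
      "\<And>a b. a \<in> {0<..1} \<Longrightarrow> b \<in> {0<..1} \<Longrightarrow> a \<le> b \<Longrightarrow> {a..b} \<inter> F = {} \<Longrightarrow> (f a > c) = (f b > c)"
      using f[of c] by (rule switches_at_mostE) (rule that)
    \<comment> \<open>Adding 1 makes the set nonempty and keeps \<open>\<delta>\<close> in the
      domain; halving the minimum puts \<open>{0<..\<delta>}\<close> to the left of all positive
      points of \<open>F\<close>.\<close>
    define G where "G = insert 1 {z\<in>F. z > 0}"
    have G: "finite G" "G \<noteq> {}" "\<And>z. z \<in> G \<Longrightarrow> z > 0" using F(1) by (auto simp: G_def)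
    define \<delta> where "\<delta> = Min G / 2"
    have "Min G > 0" using G(3) Min_in[OF G(1,2)] by blast
    moreover have "Min G \<le> 1" by (rule Min_le[OF G(1)]) (simp add: G_def)
    ultimately have \<delta>: "\<delta> \<in> {0<..1}" "\<delta> < Min G" by (auto simp: \<delta>_def)
    have "(f l > c) = (f \<delta> > c)" if "l \<in> {0<..\<delta>}" for l
    proof (rule F(2))
      have "z \<notin> F" if "z \<in> {l..\<delta>}" for z
      proof
        assume "z \<in> F"
        then have "z \<in> G" using that \<open>l \<in> {0<..\<delta>}\<close> by (simp add: G_def)
        then have "Min G \<le> z" by (rule Min_le[OF G(1)])
        then show False using \<delta> that by auto
      qed
      then show "{l..\<delta>} \<inter> F = {}" by blast
      show "l \<in> {0<..1}" "\<delta> \<in> {0<..1}" "l \<le> \<delta>" using that \<delta> by simp_all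
    qed
    then have "(\<forall>l\<in>{0<..\<delta>}. f l > c) \<or> (\<forall>l\<in>{0<..\<delta>}. f l \<le> c)"
      by (cases "f \<delta> > c") (simp_all add: not_less)
    then show ?thesis using \<delta>(1) by blast
  qed
  define A where "A = {c. \<exists>\<delta>\<in>{0<..1}. \<forall>l\<in>{0<..\<delta>}. f l > c}"
  have up: "c \<le> C" if "c \<in> A" for c
  proof -
    from that obtain \<delta> where "\<delta> \<in> {0<..1}" "f \<delta> > c" by (auto simp: A_def)
    then show ?thesis using bound[of \<delta>] by auto
  qed
  then have bdd: "bdd_above A" by (auto simp: bdd_above_def)
  have "- C - 1 < f l" if "l \<in> {0<..1}" for l using bound[OF that] by (simp add: abs_le_iff)
  then have "- C - 1 \<in> A" unfolding A_def by (intro CollectI bexI[of _ 1] ballI) simp_all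
  then have ne: "A \<noteq> {}" by blast
  define s where "s = Sup A"
  obtain c where c: "c \<in> A" "s - \<eta> / 2 < c"
    using less_cSupD[OF ne, of "s - \<eta> / 2"] \<open>\<eta> > 0\<close> by (auto simp: s_def)
  then obtain \<delta>1 where \<delta>1: "\<delta>1 \<in> {0<..1}" "\<forall>l\<in>{0<..\<delta>1}. f l > c" by (auto simp: A_def)
  have "s + \<eta> / 2 \<notin> A" using cSup_upper[OF _ bdd, of "s + \<eta> / 2"] \<open>\<eta> > 0\<close> by (auto simp: s_def)
  then obtain \<delta>2 where \<delta>2: "\<delta>2 \<in> {0<..1}" "\<forall>l\<in>{0<..\<delta>2}. f l \<le> s + \<eta> / 2"
    using ev[of "s + \<eta> / 2"] by (auto simp: A_def)
  show ?thesis
  proof (intro exI conjI ballI)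
    show "0 < min \<delta>1 \<delta>2" "min \<delta>1 \<delta>2 \<le> 1" using \<delta>1 \<delta>2 by auto
    fix l assume "l \<in> {0<..min \<delta>1 \<delta>2}"
    then have "f l > c" "f l \<le> s + \<eta> / 2" using \<delta>1 \<delta>2 by auto
    then show "f l \<in> {s - \<eta> / 2..s - \<eta> / 2 + \<eta>}" using c by (auto simp: field_simps)
  qed
qed

subsection \<open>The law of the play\<close>

text \<open>The Ionescu-Tulcea construction feeds the kernel functions restricted to
  \<open>{0..<t}\<close>; this passes to whole plays. For \<open>t = 0\<close> the kernel ignores
  its argument.\<close>

lemma play_kernel_restrict:
  "play_kernel G \<omega> \<sigma> \<rho> t (restrict p {0..<t}) = play_kernel G \<omega> \<sigma> \<rho> t p"
proof -
  have "map (restrict p {0..<t}) [0..<t] = map p [0..<t]" by simp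
  then show ?thesis unfolding play_kernel_def by (cases t) (simp_all only:, simp_all)
qed

lemma sets_play_measure [measurable_cong]:
  fixes G :: "('w::finite, 'i::finite, 'j::finite) stochastic_game"
  shows "sets (play_measure G \<omega> \<sigma> \<rho>) = sets (PiM UNIV (\<lambda>_. count_space UNIV))"
proof -
  interpret Ionescu_Tulcea "\<lambda>t p. measure_pmf (play_kernel G \<omega> \<sigma> \<rho> t p)" "\<lambda>_. count_space UNIV"
    by (rule Ionescu_Tulcea_play)
  show ?thesis unfolding play_measure_def by (rule PF.sets_lim)
qed

lemma measurable_play_kernel [measurable]:
  fixes G :: "('w::finite, 'i::finite, 'j::finite) stochastic_game"
  shows "(\<lambda>p. measure_pmf (play_kernel G \<omega> \<sigma> \<rho> t p))
    \<in> PiM UNIV (\<lambda>_. count_space UNIV) \<rightarrow>\<^sub>M subprob_algebra (count_space UNIV)"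
proof -
  interpret Ionescu_Tulcea "\<lambda>t p. measure_pmf (play_kernel G \<omega> \<sigma> \<rho> t p)" "\<lambda>_. count_space UNIV"
    by (rule Ionescu_Tulcea_play)
  have "(\<lambda>p. restrict p {0..<t}) \<in> PiM UNIV (\<lambda>_. count_space UNIV)
      \<rightarrow>\<^sub>M PiM {0..<t} (\<lambda>_. count_space (UNIV :: ('w \<times> 'i \<times> 'j) set))"
    by (rule measurable_restrict_subset) simp
  from measurable_compose[OF this P] show ?thesis by (simp only: play_kernel_restrict)
qed

text \<open>Tower property: the law of the first \<open>Suc t\<close> triples is the law of the
  first \<open>t\<close> bound with the kernel, and both are marginals of the projective
  limit.\<close>

lemma nn_integral_play_next:
  fixes G :: "('w::finite, 'i::finite, 'j::finite) stochastic_game"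
    and \<phi> :: "'w \<times> 'i \<times> 'j \<Rightarrow> ennreal"
  shows "(\<integral>\<^sup>+p. \<phi> (p t) \<partial>play_measure G \<omega> \<sigma> \<rho>) =
    (\<integral>\<^sup>+p. (\<integral>\<^sup>+z. \<phi> z \<partial>play_kernel G \<omega> \<sigma> \<rho> t p) \<partial>play_measure G \<omega> \<sigma> \<rho>)"
proof -
  let ?M = "\<lambda>_ :: nat. count_space (UNIV :: ('w \<times> 'i \<times> 'j) set)"
  interpret Ionescu_Tulcea "\<lambda>t p. measure_pmf (play_kernel G \<omega> \<sigma> \<rho> t p)" ?M
    by (rule Ionescu_Tulcea_play)
  let ?u = "\<lambda>_ :: nat. undefined :: 'w \<times> 'i \<times> 'j"
  have u: "?u \<in> space (PiM {0..<0} ?M)" by (simp add: space_PiM)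
  \<comment> \<open>\<open>C 0 n ?u\<close> iterates the kernel from the empty history;
    \<open>CI\<close> is defined through \<open>up_to\<close>, the least bound of the index set,
    which is \<open>n\<close> here.\<close>
  have law: "C 0 n ?u = distr PF.lim (PiM {0..<n} ?M) (\<lambda>p. restrict p {0..<n})" for n
  proof -
    have "up_to {0..<n} = n"
    proof (rule antisym)
      show "up_to {0..<n} \<le> n" by (subst up_to_iff_Ico) auto
      show "n \<le> up_to {0..<n}" using up_to[of "{0..<n}"] by (cases n) auto
    qed
    then have "CI {0..<n} = C 0 n ?u"
      using distr_C[of n n ?u 0] u by (simp add: CI_def)
    then show ?thesis by (subst distr_lim) auto
  qed
  have restr: "(\<lambda>p. restrict p {0..<n}) \<in> PF.lim \<rightarrow>\<^sub>M PiM {0..<n} ?M" for n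
    by (subst measurable_cong_sets[OF PF.sets_lim refl]) (rule measurable_restrict_subset, simp)
  have comp: "(\<lambda>x. \<phi> (x t)) \<in> borel_measurable (PiM {0..<Suc t} ?M)"
    by (rule measurable_compose[OF measurable_component_singleton]) auto
  have inner: "(\<lambda>x. \<integral>\<^sup>+z. \<phi> z \<partial>play_kernel G \<omega> \<sigma> \<rho> t x) \<in> borel_measurable (PiM {0..<t} ?M)"
    by (rule measurable_compose[OF P nn_integral_measurable_subprob_algebra]) simp
  have "(\<integral>\<^sup>+p. \<phi> (p t) \<partial>PF.lim) = (\<integral>\<^sup>+x. \<phi> (x t) \<partial>C 0 (Suc t) ?u)"
    unfolding law using restr comp by (subst nn_integral_distr) auto
  also have "\<dots> = (\<integral>\<^sup>+x. (\<integral>\<^sup>+y. \<phi> (y t) \<partial>eP t x) \<partial>C 0 t ?u)"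
    unfolding C.simps add_0
  proof (rule nn_integral_bind[OF comp])
    have "eP t \<in> PiM {0..<t} ?M \<rightarrow>\<^sub>M subprob_algebra (PiM {0..<Suc t} ?M)" by simp
    then show "eP t \<in> C 0 t ?u \<rightarrow>\<^sub>M subprob_algebra (PiM {0..<Suc t} ?M)"
      using sets_C[OF u, of t] by (simp cong: measurable_cong_sets)
  qed
  also have "\<dots> = (\<integral>\<^sup>+x. (\<integral>\<^sup>+z. \<phi> z \<partial>play_kernel G \<omega> \<sigma> \<rho> t x) \<partial>C 0 t ?u)"
  proof (rule nn_integral_cong)
    fix x assume "x \<in> space (C 0 t ?u)"
    then have "x \<in> space (PiM {0..<t} ?M)" by (simp add: space_C[OF u])
    then show "(\<integral>\<^sup>+y. \<phi> (y t) \<partial>eP t x) = (\<integral>\<^sup>+z. \<phi> z \<partial>play_kernel G \<omega> \<sigma> \<rho> t x)"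
      by (subst nn_integral_eP[OF _ comp]) simp_all
  qed
  also have "\<dots> = (\<integral>\<^sup>+p. (\<integral>\<^sup>+z. \<phi> z \<partial>play_kernel G \<omega> \<sigma> \<rho> t p) \<partial>PF.lim)"
    unfolding law using restr inner
    by (subst nn_integral_distr) (auto simp: play_kernel_restrict)
  finally show ?thesis unfolding play_measure_def .
qed

lemma integrable_play:
  fixes G :: "('w::finite, 'i::finite, 'j::finite) stochastic_game"
    and \<phi> :: "'w \<times> 'i \<times> 'j \<Rightarrow> real"
  shows "integrable (play_measure G \<omega> \<sigma> \<rho>) (\<lambda>p. \<phi> (p t))"
proof -
  interpret prob_space "play_measure G \<omega> \<sigma> \<rho>" by (rule prob_space_play_measure)
  have "(\<lambda>p. \<phi> (p t)) \<in> borel_measurable (play_measure G \<omega> \<sigma> \<rho>)"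
    by measurable
  then show ?thesis
    by (intro integrable_const_bound[where B = "Max (range (\<lambda>z. \<bar>\<phi> z\<bar>))"]) auto
qed

text \<open>Reduced to the nonnegative case by adding a bound \<open>B\<close> of
  \<open>\<bar>\<phi>\<bar>\<close> and subtracting it again.\<close>

lemma integral_play_next:
  fixes G :: "('w::finite, 'i::finite, 'j::finite) stochastic_game"
    and \<phi> :: "'w \<times> 'i \<times> 'j \<Rightarrow> real"
  shows "(\<integral>p. \<phi> (p t) \<partial>play_measure G \<omega> \<sigma> \<rho>) =
    (\<integral>p. (\<integral>z. \<phi> z \<partial>play_kernel G \<omega> \<sigma> \<rho> t p) \<partial>play_measure G \<omega> \<sigma> \<rho>)"
proof -
  let ?P = "play_measure G \<omega> \<sigma> \<rho>"
  interpret prob_space ?P by (rule prob_space_play_measure)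
  define B where "B = Max (range (\<lambda>z. \<bar>\<phi> z\<bar>))"
  have B: "\<bar>\<phi> z\<bar> \<le> B" for z by (simp add: B_def)
  have nn: "\<phi> z + B \<ge> 0" for z using B[of z] by linarith
  have fin: "integrable (measure_pmf D) \<psi>" for D :: "('w \<times> 'i \<times> 'j) pmf" and \<psi> :: "_ \<Rightarrow> real"
    by (rule integrable_measure_pmf_finite) simp
  define K where "K p = (\<integral>z. \<phi> z \<partial>play_kernel G \<omega> \<sigma> \<rho> t p)" for p
  \<comment> \<open>On a finite type the conditional expectation is a finite combination of point
    masses of the kernel, hence measurable.\<close>
  have "K = (\<lambda>p. \<Sum>z\<in>UNIV. measure (play_kernel G \<omega> \<sigma> \<rho> t p) {z} * \<phi> z)"
    unfolding K_def by (subst integral_measure_pmf_real[of UNIV]) (auto simp: measure_pmf_single mult.commute)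
  moreover have "(\<lambda>p. \<Sum>z\<in>UNIV. measure (play_kernel G \<omega> \<sigma> \<rho> t p) {z} * \<phi> z) \<in> borel_measurable ?P"
    by (intro borel_measurable_sum borel_measurable_times
         measurable_compose[OF measurable_play_kernel[THEN measurable_cong_sets[OF sets_play_measure refl, THEN equalityD2, THEN subsetD]]
           measurable_measure_subprob_algebra]) auto
  ultimately have Kmeas: "K \<in> borel_measurable ?P" by simp
  have Kb: "\<bar>K p\<bar> \<le> B" for p
    unfolding K_def using B
    by (intro order.trans[OF integral_abs_bound] measure_pmf.integral_le_const fin) auto
  have Kn: "K p + B \<ge> 0" for p using Kb[of p] by linarith
  have int: "integrable ?P K"
    using Kmeas Kb by (intro integrable_const_bound[where B = B]) auto
  have "ennreal ((\<integral>p. \<phi> (p t) \<partial>?P) + B) = ennreal (\<integral>p. \<phi> (p t) + B \<partial>?P)"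
    using integrable_play[of G \<omega> \<sigma> \<rho> \<phi> t] by (simp add: prob_space)
  also have "\<dots> = (\<integral>\<^sup>+p. ennreal (\<phi> (p t) + B) \<partial>?P)"
    using integrable_play[of G \<omega> \<sigma> \<rho> "\<lambda>z. \<phi> z + B" t] nn
    by (intro nn_integral_eq_integral[symmetric]) auto
  also have "\<dots> = (\<integral>\<^sup>+p. (\<integral>\<^sup>+z. ennreal (\<phi> z + B) \<partial>play_kernel G \<omega> \<sigma> \<rho> t p) \<partial>?P)"
    by (rule nn_integral_play_next)
  also have "\<dots> = (\<integral>\<^sup>+p. ennreal (K p + B) \<partial>?P)"
    unfolding K_def using nn fin by (intro nn_integral_cong, subst nn_integral_eq_integral) auto
  also have "\<dots> = ennreal (\<integral>p. K p + B \<partial>?P)"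
    using int Kn
    by (intro nn_integral_eq_integral) auto
  also have "\<dots> = ennreal ((\<integral>p. K p \<partial>?P) + B)"
    using int by (simp add: prob_space)
  finally have "(\<integral>p. \<phi> (p t) \<partial>?P) + B = (\<integral>p. K p \<partial>?P) + B"
  proof (rule ennreal_inj[THEN iffD1, rotated 2])
    have "0 \<le> (\<integral>p. \<phi> (p t) + B \<partial>?P)" using nn by (intro integral_nonneg_AE) auto
    then show "0 \<le> (\<integral>p. \<phi> (p t) \<partial>?P) + B"
      using integrable_play[of G \<omega> \<sigma> \<rho> \<phi> t] by (simp add: prob_space)
    have "0 \<le> (\<integral>p. K p + B \<partial>?P)" using Kn by (intro integral_nonneg_AE) auto
    then show "0 \<le> (\<integral>p. K p \<partial>?P) + B"
      using int by (simp add: prob_space)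
  qed
  then show ?thesis unfolding K_def by simp
qed

lemma integral_play_kernel:
  fixes G :: "('w::finite, 'i::finite, 'j::finite) stochastic_game"
    and \<phi> :: "'w \<times> 'i \<times> 'j \<Rightarrow> real"
  shows "(\<integral>z. \<phi> z \<partial>play_kernel G \<omega> \<sigma> \<rho> t p) =
    (\<Sum>w\<in>UNIV. pmf (if t = 0 then return_pmf \<omega> else (case p (t - 1) of (w, i, j) \<Rightarrow> transition G w i j)) w *
      (\<Sum>i\<in>UNIV. \<Sum>j\<in>UNIV. pmf (\<sigma> (map p [0..<t]) w) i * pmf (\<rho> (map p [0..<t]) w) j * \<phi> (w, i, j)))"
proof -
  have pair: "(\<integral>z. \<phi> z \<partial>map_pmf (Pair w) (pair_pmf A B)) =
    (\<Sum>i\<in>UNIV. \<Sum>j\<in>UNIV. pmf A i * pmf B j * \<phi> (w, i, j))" for w A B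
  proof -
    have "(\<integral>z. \<phi> z \<partial>map_pmf (Pair w) (pair_pmf A B)) = (\<integral>z. \<phi> (w, z) \<partial>pair_pmf A B)"
      by simp
    also have "\<dots> = (\<Sum>z\<in>UNIV. \<phi> (w, z) * pmf (pair_pmf A B) z)"
      by (intro integral_measure_pmf_real) auto
    also have "\<dots> = (\<Sum>i\<in>UNIV. \<Sum>j\<in>UNIV. pmf A i * pmf B j * \<phi> (w, i, j))"
      unfolding sum.cartesian_product UNIV_Times_UNIV
      by (intro sum.cong) (auto simp: pmf_pair mult.commute)
    finally show ?thesis .
  qed
  show ?thesis
    unfolding play_kernel_def
    by (subst pmf_expectation_bind[of UNIV]) (simp_all only: pair finite_UNIV finite subset_UNIV real_scaleR_def)
qed

definition next_value :: "('w, 'i, 'j) stochastic_game \<Rightarrow> ('w \<Rightarrow> real) \<Rightarrow> 'w \<Rightarrow> 'i \<Rightarrow> 'j \<Rightarrow> real" where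
  "next_value G f w i j = (\<Sum>w'\<in>UNIV. pmf (transition G w i j) w' * f w')"

lemma sum_pmf_mult_pmf:
  fixes X :: "'i::finite pmf" and Y :: "'j::finite pmf"
  shows "(\<Sum>i\<in>UNIV. \<Sum>j\<in>UNIV. pmf X i * pmf Y j * c) = c"
  by (simp add: sum_distrib_left[symmetric] sum_distrib_right[symmetric] sum_pmf_eq_1)

lemma integral_initial_state:
  fixes G :: "('w::finite, 'i::finite, 'j::finite) stochastic_game" and f :: "'w \<Rightarrow> real"
  shows "(\<integral>p. f (fst (p 0)) \<partial>play_measure G \<omega> \<sigma> \<rho>) = f \<omega>"
proof -
  interpret prob_space "play_measure G \<omega> \<sigma> \<rho>" by (rule prob_space_play_measure)
  show ?thesis
    by (subst integral_play_next[where \<phi> = "\<lambda>z. f (fst z)"])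
      (simp add: integral_play_kernel sum_pmf_mult_pmf prob_space indicator_def sum.delta if_distrib cong: if_cong)
qed

lemma integral_next_state:
  fixes G :: "('w::finite, 'i::finite, 'j::finite) stochastic_game" and f :: "'w \<Rightarrow> real"
  shows "(\<integral>p. f (fst (p (Suc t))) \<partial>play_measure G \<omega> \<sigma> \<rho>) =
    (\<integral>p. (case p t of (w, i, j) \<Rightarrow> next_value G f w i j) \<partial>play_measure G \<omega> \<sigma> \<rho>)"
  by (subst integral_play_next[where \<phi> = "\<lambda>z. f (fst z)"])
    (simp add: integral_play_kernel sum_pmf_mult_pmf next_value_def case_prod_unfold)

text \<open>Conditioning on the history: this carries one-stage inequalities over to expectations
  along the play. Only histories of length \<open>t\<close> enter, which is what an adapted profile
  prescribes for stage \<open>t + 1\<close>.\<close>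

lemma integral_play_nonneg:
  fixes G :: "('w::finite, 'i::finite, 'j::finite) stochastic_game" and \<phi> :: "'w \<times> 'i \<times> 'j \<Rightarrow> real"
  assumes "\<And>h w. length h = t \<Longrightarrow>
    (\<Sum>i\<in>UNIV. \<Sum>j\<in>UNIV. pmf (\<sigma> h w) i * pmf (\<rho> h w) j * \<phi> (w, i, j)) \<ge> 0"
  shows "(\<integral>p. \<phi> (p t) \<partial>play_measure G \<omega> \<sigma> \<rho>) \<ge> 0"
  unfolding integral_play_next[where \<phi> = \<phi>] integral_play_kernel
  by (intro integral_nonneg_AE AE_I2 sum_nonneg mult_nonneg_nonneg assms) simp_all

subsection \<open>Discounted games\<close>

definition mix :: "('w \<Rightarrow> 'i pmf) \<Rightarrow> ('w \<Rightarrow> 'j pmf) \<Rightarrow> ('w \<Rightarrow> 'i \<Rightarrow> 'j \<Rightarrow> real) \<Rightarrow> 'w \<Rightarrow> real" where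
  "mix x y f w = (\<Sum>i\<in>UNIV. \<Sum>j\<in>UNIV. pmf (x w) i * pmf (y w) j * f w i j)"

lemma mix_add: "mix x y (\<lambda>w i j. f w i j + g w i j) w = mix x y f w + mix x y g w"
  by (simp add: mix_def sum.distrib algebra_simps)

lemma mix_diff: "mix x y (\<lambda>w i j. f w i j - g w i j) w = mix x y f w - mix x y g w"
  by (simp add: mix_def sum_subtractf algebra_simps)

lemma mix_scale: "mix x y (\<lambda>w i j. c * f w i j) w = c * mix x y f w"
  by (simp add: mix_def sum_distrib_left algebra_simps)

lemma mix_const:
  fixes x :: "'w \<Rightarrow> 'i::finite pmf" and y :: "'w \<Rightarrow> 'j::finite pmf"
  shows "mix x y (\<lambda>w i j. f w) w = f w"
  by (simp add: mix_def sum_pmf_mult_pmf)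

lemma mix_nonneg: "(\<And>i j. f w i j \<ge> 0) \<Longrightarrow> mix x y f w \<ge> 0"
  by (auto simp: mix_def intro!: sum_nonneg)

lemma mix_mono:
  "(\<And>i j. f w i j \<le> g w i j) \<Longrightarrow> mix x y f w \<le> mix x y g w"
  by (auto simp: mix_def intro!: sum_mono mult_left_mono)

section \<open>Stationary pairs: maximum principle and payoff equation\<close>

definition trans_prob ::
  "('w, 'i, 'j) stochastic_game \<Rightarrow> ('w \<Rightarrow> 'i pmf) \<Rightarrow> ('w \<Rightarrow> 'j pmf) \<Rightarrow> 'w \<Rightarrow> 'w \<Rightarrow> real" where
  "trans_prob G x y w w' = mix x y (\<lambda>w i j. pmf (transition G w i j) w') w"

lemma trans_prob_nonneg: "trans_prob G x y w w' \<ge> 0"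
  by (auto simp: trans_prob_def intro: mix_nonneg)

lemma mix_next_value:
  "mix x y (next_value G f) w = (\<Sum>w'\<in>UNIV. trans_prob G x y w w' * f w')"
proof -
  have "mix x y (next_value G f) w = (\<Sum>i\<in>UNIV. \<Sum>j\<in>UNIV. \<Sum>w'\<in>UNIV.
      pmf (x w) i * pmf (y w) j * pmf (transition G w i j) w' * f w')"
    by (simp add: mix_def next_value_def sum_distrib_left mult.assoc)
  also have "\<dots> = (\<Sum>i\<in>UNIV. \<Sum>w'\<in>UNIV. \<Sum>j\<in>UNIV.
      pmf (x w) i * pmf (y w) j * pmf (transition G w i j) w' * f w')"
    by (intro sum.cong refl sum.swap)
  also have "\<dots> = (\<Sum>w'\<in>UNIV. \<Sum>i\<in>UNIV. \<Sum>j\<in>UNIV.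
      pmf (x w) i * pmf (y w) j * pmf (transition G w i j) w' * f w')"
    by (rule sum.swap)
  finally show ?thesis by (simp add: trans_prob_def mix_def sum_distrib_right)
qed

lemma sum_trans_prob:
  fixes G :: "('w::finite, 'i::finite, 'j::finite) stochastic_game"
  shows "(\<Sum>w'\<in>UNIV. trans_prob G x y w w') = 1"
proof -
  have "next_value G (\<lambda>_. 1) = (\<lambda>w i j. 1)" by (simp add: next_value_def sum_pmf_eq_1 fun_eq_iff)
  then show ?thesis using mix_next_value[of x y G "\<lambda>_. 1" w] mix_const[of x y "\<lambda>_. 1" w] by simp
qed

text \<open>At a state where \<open>e\<close> attains its maximum \<open>m\<close> the average is at
  most \<open>m\<close>, so \<open>m \<le> l * M + (1 - l) * m\<close>, and \<open>l > 0\<close>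
  cancels.\<close>

lemma discounted_maximum_principle:
  fixes Q :: "'w::finite \<Rightarrow> 'w \<Rightarrow> real" and e :: "'w \<Rightarrow> real"
  assumes Q: "\<And>w w'. Q w w' \<ge> 0" "\<And>w. (\<Sum>w'\<in>UNIV. Q w w') = 1"
    and l: "0 < l" "l \<le> 1"
    and e: "\<And>w. e w \<le> l * M + (1 - l) * (\<Sum>w'\<in>UNIV. Q w w' * e w')"
  shows "e w \<le> M"
proof -
  define m where "m = Max (range e)"
  have le: "e w \<le> m" for w by (simp add: m_def)
  have "m \<in> range e" unfolding m_def by (rule Max_in) auto
  then obtain w1 where w1: "e w1 = m" by auto
  have "(\<Sum>w'\<in>UNIV. Q w1 w' * e w') \<le> (\<Sum>w'\<in>UNIV. Q w1 w' * m)"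
    by (intro sum_mono mult_left_mono le Q)
  also have "\<dots> = m" using Q(2) by (simp add: sum_distrib_right[symmetric])
  finally have "m \<le> l * M + (1 - l) * m"
    using e[of w1] w1 l by (smt (verit) mult_left_mono)
  then have "l * m \<le> l * M" by (simp add: algebra_simps)
  then have "m \<le> M" using l by simp
  then show ?thesis using le[of w] by linarith
qed

text \<open>The matrix \<open>I - (1 - l) Q\<close> with \<open>Q\<close> the transition matrix of
  the pair. The discounted payoff vector solves the linear system with this matrix and right-hand
  side \<open>l\<close> times the mean stage payoff.\<close>

definition resolvent ::
  "('w::finite, 'i, 'j) stochastic_game \<Rightarrow> real \<Rightarrow> ('w \<Rightarrow> 'i pmf) \<Rightarrow> ('w \<Rightarrow> 'j pmf) \<Rightarrow> real^'w^'w" where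
  "resolvent G l x y = (\<chi> w w'. (if w = w' then 1 else 0) - (1 - l) * trans_prob G x y w w')"

lemma resolvent_mult:
  "(resolvent G l x y *v z) $ w = z $ w - (1 - l) * (\<Sum>w'\<in>UNIV. trans_prob G x y w w' * z $ w')"
proof -
  have "(resolvent G l x y *v z) $ w = (\<Sum>w'\<in>UNIV. (if w = w' then z $ w' else 0)) -
      (\<Sum>w'\<in>UNIV. (1 - l) * (trans_prob G x y w w' * z $ w'))"
    unfolding sum_subtractf[symmetric] resolvent_def matrix_vector_mult_def
    by (auto intro!: sum.cong simp: algebra_simps)
  then show ?thesis by (simp add: sum_distrib_left)
qed

text \<open>A kernel vector is \<open>1 - l\<close> times its own average, so the maximum principle
  with \<open>M = 0\<close>, applied to \<open>z\<close> and \<open>- z\<close>, makes it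
  vanish.\<close>

lemma det_resolvent_nonzero:
  fixes G :: "('w::finite, 'i::finite, 'j::finite) stochastic_game"
  assumes "0 < l" "l \<le> 1"
  shows "det (resolvent G l x y) \<noteq> 0"
proof -
  have "z = 0" if z: "resolvent G l x y *v z = 0" for z
  proof -
    have eq: "z $ w = (1 - l) * (\<Sum>w'\<in>UNIV. trans_prob G x y w w' * z $ w')" for w
      using resolvent_mult[of G l x y z w] z by simp
    note maximum = discounted_maximum_principle[where Q = "trans_prob G x y" and M = 0,
        OF trans_prob_nonneg sum_trans_prob assms]
    have "z $ w \<le> 0" for w
      by (rule maximum[where e = "\<lambda>w. z $ w"]) (simp flip: eq)
    moreover have "- z $ w \<le> 0" for w
      by (rule maximum[where e = "\<lambda>w. - z $ w"]) (simp add: sum_negf flip: eq)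
    ultimately show "z = 0" by (simp add: vec_eq_iff antisym)
  qed
  then have "\<exists>B. B ** resolvent G l x y = mat 1"
    by (simp add: matrix_left_invertible_ker)
  then show ?thesis by (simp add: invertible_left_inverse flip: invertible_det_nz)
qed

text \<open>Moving the discount factor to 1 turns the matrix into the identity; the determinant is
  continuous and has no zero on the way. The sign matters when the denominator in Cramer's rule is
  cleared.\<close>

lemma det_resolvent_pos:
  fixes G :: "('w::finite, 'i::finite, 'j::finite) stochastic_game"
  assumes "0 < l" "l \<le> 1"
  shows "det (resolvent G l x y) > 0"
proof (rule ccontr)
  assume "\<not> ?thesis"
  then have neg: "det (resolvent G l x y) \<le> 0" by simp
  have "resolvent G 1 x y = mat 1" by (simp add: resolvent_def mat_def)
  then have one: "det (resolvent G 1 x y) = 1" by (simp only: det_I)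
  have cont: "continuous_on {l..1} (\<lambda>s. det (resolvent G s x y))"
    unfolding det_def resolvent_def by (auto intro!: continuous_intros)
  have "\<exists>s\<ge>l. s \<le> 1 \<and> det (resolvent G s x y) = 0"
    using neg one assms cont by (intro IVT') simp_all
  then obtain s where "l \<le> s" "s \<le> 1" "det (resolvent G s x y) = 0" by blast
  then show False using det_resolvent_nonzero[of s G x y] assms by simp
qed

lemma ex_stationary_value:
  fixes G :: "('w::finite, 'i::finite, 'j::finite) stochastic_game"
  assumes "0 < l" "l \<le> 1"
  shows "\<exists>u. \<forall>w. u w = l * mix x y (payoff G) w + (1 - l) * (\<Sum>w'\<in>UNIV. trans_prob G x y w w' * u w')"
proof -
  have "invertible (resolvent G l x y)"
    using det_resolvent_nonzero[OF assms] by (simp add: invertible_det_nz)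
  then obtain z where z: "resolvent G l x y *v z = (\<chi> w. l * mix x y (payoff G) w)"
    by (metis invertible_def matrix_vector_mul_assoc matrix_vector_mul_lid)
  have "z $ w = l * mix x y (payoff G) w + (1 - l) * (\<Sum>w'\<in>UNIV. trans_prob G x y w w' * z $ w')" for w
    using resolvent_mult[of G l x y z w] unfolding z by simp
  then show ?thesis by (intro exI[of _ "\<lambda>w. z $ w"] allI)
qed

definition max_payoff :: "('w, 'i, 'j) stochastic_game \<Rightarrow> real" where
  "max_payoff G = Max (range (\<lambda>(w, i, j). \<bar>payoff G w i j\<bar>))"

lemma payoff_le:
  fixes G :: "('w::finite, 'i::finite, 'j::finite) stochastic_game"
  shows "\<bar>payoff G w i j\<bar> \<le> max_payoff G"
  unfolding max_payoff_def by (rule Max_ge) (auto intro: rev_image_eqI[of "(w, i, j)"])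

definition stage_reward :: "('w, 'i, 'j) stochastic_game \<Rightarrow> 'w \<times> 'i \<times> 'j \<Rightarrow> real" where
  "stage_reward G z = (case z of (w, i, j) \<Rightarrow> payoff G w i j)"

lemma stage_reward_le:
  fixes G :: "('w::finite, 'i::finite, 'j::finite) stochastic_game"
  shows "\<bar>stage_reward G z\<bar> \<le> max_payoff G"
  by (auto simp: stage_reward_def payoff_le split: prod.split)

lemma integral_play_bounded:
  fixes G :: "('w::finite, 'i::finite, 'j::finite) stochastic_game" and \<phi> :: "'w \<times> 'i \<times> 'j \<Rightarrow> real"
  assumes "\<And>z. \<bar>\<phi> z\<bar> \<le> B"
  shows "\<bar>\<integral>p. \<phi> (p t) \<partial>play_measure G \<omega> \<sigma> \<rho>\<bar> \<le> B"
proof -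
  interpret prob_space "play_measure G \<omega> \<sigma> \<rho>" by (rule prob_space_play_measure)
  show ?thesis
    using assms integrable_play[of G \<omega> \<sigma> \<rho> \<phi> t]
    by (intro order.trans[OF integral_abs_bound] integral_le_const) auto
qed

lemma integral_stage_deficit:
  fixes G :: "('w::finite, 'i::finite, 'j::finite) stochastic_game" and f :: "'w \<Rightarrow> real"
  shows "(\<integral>p. (case p t of (w, i, j) \<Rightarrow> l * payoff G w i j + (1 - l) * next_value G f w i j - f w)
      \<partial>play_measure G \<omega> \<sigma> \<rho>) =
    l * (\<integral>p. stage_reward G (p t) \<partial>play_measure G \<omega> \<sigma> \<rho>)
    + (1 - l) * (\<integral>p. f (fst (p (Suc t))) \<partial>play_measure G \<omega> \<sigma> \<rho>)
    - (\<integral>p. f (fst (p t)) \<partial>play_measure G \<omega> \<sigma> \<rho>)"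
proof -
  let ?P = "play_measure G \<omega> \<sigma> \<rho>"
  note int = integrable_play[where G = G and \<omega> = \<omega> and \<sigma> = \<sigma> and \<rho> = \<rho> and t = t]
  have "(\<integral>p. (case p t of (w, i, j) \<Rightarrow> l * payoff G w i j + (1 - l) * next_value G f w i j - f w) \<partial>?P)
    = (\<integral>p. l * stage_reward G (p t) +
        (1 - l) * (case p t of (w, i, j) \<Rightarrow> next_value G f w i j) - f (fst (p t)) \<partial>?P)"
    by (intro Bochner_Integration.integral_cong) (auto simp: stage_reward_def split: prod.split)
  then show ?thesis
    unfolding integral_next_state
    using int[of "stage_reward G"] int[of "\<lambda>z. f (fst z)"]
      int[of "\<lambda>z. case z of (w, i, j) \<Rightarrow> next_value G f w i j"]
    by (simp add: Bochner_Integration.integral_diff Bochner_Integration.integral_add)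
qed

text \<open>The equation for \<open>u\<close> gives
  \<open>l * b t = a t - (1 - l) * a (Suc t)\<close> for the expected rewards \<open>b\<close> and
  expected values \<open>a\<close>, so the discounted sum telescopes to
  \<open>a 0 = u \<omega>\<close>.\<close>

lemma discounted_payoff_stationary:
  fixes G :: "('w::finite, 'i::finite, 'j::finite) stochastic_game"
  assumes l: "0 < l" "l \<le> 1"
    and u: "\<And>w. u w = l * mix x y (payoff G) w + (1 - l) * (\<Sum>w'\<in>UNIV. trans_prob G x y w w' * u w')"
  shows "discounted_payoff G l \<omega> (stationary x) (stationary y) = u \<omega>"
proof -
  let ?P = "play_measure G \<omega> (stationary x) (stationary y)"
  interpret prob_space ?P by (rule prob_space_play_measure)
  define \<phi> where "\<phi> z = (case z of (w, i, j) \<Rightarrow>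
    l * payoff G w i j + (1 - l) * next_value G u w i j - u w)" for z
  define b where "b t = (\<integral>p. stage_reward G (p t) \<partial>?P)" for t
  define a where "a t = (\<integral>p. u (fst (p t)) \<partial>?P)" for t
  note int = integrable_play[where G = G and \<omega> = \<omega> and \<sigma> = "stationary x" and \<rho> = "stationary y"]
  have zero: "(\<Sum>i\<in>UNIV. \<Sum>j\<in>UNIV. pmf (x w) i * pmf (y w) j * \<phi> (w, i, j)) = 0" for w
  proof -
    have "(\<Sum>i\<in>UNIV. \<Sum>j\<in>UNIV. pmf (x w) i * pmf (y w) j * \<phi> (w, i, j)) =
      mix x y (\<lambda>w i j. l * payoff G w i j + (1 - l) * next_value G u w i j - u w) w"
      by (simp add: mix_def \<phi>_def)
    also have "\<dots> = 0"
      using u[of w] by (simp add: mix_add mix_diff mix_scale mix_const mix_next_value)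
    finally show ?thesis .
  qed
  have step: "l * b t = a t - (1 - l) * a (Suc t)" for t
  proof -
    have "(\<integral>p. \<phi> (p t) \<partial>?P) \<ge> 0"
      by (rule integral_play_nonneg) (simp add: stationary_def zero)
    moreover have "(\<integral>p. - \<phi> (p t) \<partial>?P) \<ge> 0"
      by (rule integral_play_nonneg[where \<phi> = "\<lambda>z. - \<phi> z"])
        (simp add: stationary_def zero sum_negf)
    ultimately have "(\<integral>p. \<phi> (p t) \<partial>?P) = 0" by simp
    moreover have "(\<integral>p. \<phi> (p t) \<partial>?P) = l * b t + (1 - l) * a (Suc t) - a t"
      unfolding a_def b_def \<phi>_def by (rule integral_stage_deficit)
    ultimately show ?thesis by linarith
  qed
  have aB: "\<bar>a t\<bar> \<le> Max (range (\<lambda>w. \<bar>u w\<bar>))" for t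
    unfolding a_def by (rule integral_play_bounded[where \<phi> = "\<lambda>z. u (fst z)"]) simp
  have geo: "summable (\<lambda>t. (1 - l) ^ t)" using l by (intro summable_geometric) auto
  have lim: "(\<lambda>t. (1 - l) ^ t * a t) \<longlonglongrightarrow> 0"
  proof (rule Lim_null_comparison)
    show "\<forall>\<^sub>F t in sequentially. norm ((1 - l) ^ t * a t) \<le> (1 - l) ^ t * Max (range (\<lambda>w. \<bar>u w\<bar>))"
      using aB l by (intro always_eventually allI) (auto simp: abs_mult intro!: mult_left_mono)
    show "(\<lambda>t. (1 - l) ^ t * Max (range (\<lambda>w. \<bar>u w\<bar>))) \<longlonglongrightarrow> 0"
      using tendsto_mult_right[OF summable_LIMSEQ_zero[OF geo]] by (simp add: tendsto_mult_left_zero summable_LIMSEQ_zero[OF geo])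
  qed
  have "discounted_payoff G l \<omega> (stationary x) (stationary y) =
      (\<integral>p. (\<Sum>t. l * (1 - l) ^ t * stage_reward G (p t)) \<partial>?P)"
    by (simp add: discounted_payoff_def stage_payoff_def stage_reward_def)
  also have "\<dots> = (\<Sum>t. \<integral>p. l * (1 - l) ^ t * stage_reward G (p t) \<partial>?P)"
  proof (rule integral_suminf)
    show "integrable ?P (\<lambda>p. l * (1 - l) ^ t * stage_reward G (p t))" for t
      using int[of "stage_reward G" t] by simp
    have bound: "norm (l * (1 - l) ^ t * stage_reward G z) \<le> (1 - l) ^ t * max_payoff G" for t z
    proof -
      have "l * ((1 - l) ^ t * \<bar>stage_reward G z\<bar>) \<le> 1 * ((1 - l) ^ t * max_payoff G)"
        using l stage_reward_le[of G z] by (intro mult_mono mult_left_mono) auto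
      then show ?thesis using l by (simp add: abs_mult mult.assoc)
    qed
    have sB: "summable (\<lambda>t. (1 - l) ^ t * max_payoff G)" using geo by (rule summable_mult2)
    show "AE p in ?P. summable (\<lambda>t. norm (l * (1 - l) ^ t * stage_reward G (p t)))"
      by (intro AE_I2 summable_comparison_test_ev[OF _ sB] always_eventually allI)
        (use bound in simp)
    show "summable (\<lambda>t. \<integral>p. norm (l * (1 - l) ^ t * stage_reward G (p t)) \<partial>?P)"
    proof (intro summable_comparison_test_ev[OF _ sB] always_eventually allI)
      fix t
      have "(\<integral>p. norm (l * (1 - l) ^ t * stage_reward G (p t)) \<partial>?P) \<le> (1 - l) ^ t * max_payoff G"
        using int[of "stage_reward G" t] bound by (intro integral_le_const) auto
      then show "norm (\<integral>p. norm (l * (1 - l) ^ t * stage_reward G (p t)) \<partial>?P) \<le> (1 - l) ^ t * max_payoff G"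
        by simp
    qed
  qed
  also have "\<dots> = (\<Sum>t. (1 - l) ^ t * a t - (1 - l) ^ Suc t * a (Suc t))"
  proof (intro suminf_cong)
    fix t
    have "(\<integral>p. l * (1 - l) ^ t * stage_reward G (p t) \<partial>?P) = (1 - l) ^ t * (l * b t)" by (simp add: b_def)
    then show "(\<integral>p. l * (1 - l) ^ t * stage_reward G (p t) \<partial>?P) = (1 - l) ^ t * a t - (1 - l) ^ Suc t * a (Suc t)"
      by (simp add: step algebra_simps)
  qed
  also have "\<dots> = a 0"
    using telescope_sums'[OF lim] by (simp add: sums_iff)
  also have "\<dots> = u \<omega>" unfolding a_def by (rule integral_initial_state)
  finally show ?thesis .
qed

section \<open>One-shot deviations and the Shapley inequalities\<close>

lemma mix_deficit:
  fixes G :: "('w::finite, 'i::finite, 'j::finite) stochastic_game"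
  shows "mix x y (\<lambda>w i j. l * payoff G w i j + (1 - l) * next_value G f w i j - f w) w =
    l * mix x y (payoff G) w + (1 - l) * (\<Sum>w'\<in>UNIV. trans_prob G x y w w' * f w') - f w"
  by (simp add: mix_add mix_diff mix_scale mix_const mix_next_value)

lemma mix_pure_right:
  fixes x :: "'w \<Rightarrow> 'i::finite pmf" and y :: "'w \<Rightarrow> 'j::finite pmf"
  assumes "y w = return_pmf j"
  shows "mix x y f w = (\<Sum>i\<in>UNIV. pmf (x w) i * f w i j)"
  using assms by (simp add: mix_def indicator_def of_bool_def if_distrib if_distribR cong: if_cong)

lemma mix_pure_left:
  fixes x :: "'w \<Rightarrow> 'i::finite pmf" and y :: "'w \<Rightarrow> 'j::finite pmf"
  assumes "x w = return_pmf i"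
  shows "mix x y f w = (\<Sum>j\<in>UNIV. pmf (y w) j * f w i j)"
proof -
  have "mix x y f w = (\<Sum>j\<in>UNIV. \<Sum>i'\<in>UNIV. pmf (x w) i' * pmf (y w) j * f w i' j)"
    unfolding mix_def by (rule sum.swap)
  then show ?thesis
    using assms by (simp add: indicator_def of_bool_def if_distrib if_distribR cong: if_cong)
qed

text \<open>
  Applied to a stationary strategy that differs from the optimal one only at \<open>w0\<close>: \<open>e\<close> is the resulting
  gain of the opponent of the deviator and \<open>D\<close> the defect in the Shapley equation.
\<close>

lemma one_shot_deviation:
  fixes Q :: "'w::finite \<Rightarrow> 'w \<Rightarrow> real" and e D :: "'w \<Rightarrow> real"
  assumes Q: "\<And>w w'. Q w w' \<ge> 0" "\<And>w. (\<Sum>w'\<in>UNIV. Q w w') = 1"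
    and l: "0 < l" "l \<le> 1"
    and e: "\<And>w. e w = D w + (1 - l) * (\<Sum>w'\<in>UNIV. Q w w' * e w')"
    and nonneg: "\<And>w. e w \<ge> 0" and D: "\<And>w. w \<noteq> w0 \<Longrightarrow> D w = 0"
  shows "D w0 \<ge> 0"
proof (rule ccontr)
  assume neg: "\<not> D w0 \<ge> 0"
  \<comment> \<open>With \<open>D \<le> 0\<close> everywhere the maximum principle gives
    \<open>e \<le> 0\<close>; together with \<open>nonneg\<close> this forces \<open>e = 0\<close>,
    hence \<open>D w0 = 0\<close>.\<close>
  then have "D w \<le> 0" for w using D[of w] by (cases "w = w0") auto
  then have "e w \<le> l * 0 + (1 - l) * (\<Sum>w'\<in>UNIV. Q w w' * e w')" for w
    using e[of w] by simp
  from discounted_maximum_principle[where e = e, OF Q l this] have "e w \<le> 0" for w .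
  then have "e w = 0" for w using nonneg[of w] by (simp add: antisym)
  then show False using e[of w0] neg by simp
qed

context
  fixes G :: "('w::finite, 'i::finite, 'j::finite) stochastic_game"
    and x :: "real \<Rightarrow> 'w \<Rightarrow> 'i pmf" and y :: "real \<Rightarrow> 'w \<Rightarrow> 'j pmf" and l :: real
  assumes opt: "discounted_optimal_stationary_profile G x y" and l: "0 < l" "l \<le> 1"
begin

lemma discounted_payoff_optimal1:
  "discounted_payoff G l \<omega> (stationary (x l)) \<rho> \<ge> discounted_value G l \<omega>"
  using opt l by (simp add: discounted_optimal_stationary_profile_def discounted_optimal1_def)

lemma discounted_payoff_optimal2:
  "discounted_payoff G l \<omega> \<sigma> (stationary (y l)) \<le> discounted_value G l \<omega>"
  using opt l by (simp add: discounted_optimal_stationary_profile_def discounted_optimal2_def)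

text \<open>Optimality on both sides squeezes the payoff of the pair \<open>x l\<close>,
  \<open>y l\<close> onto the value, and that payoff solves the linear equation.\<close>

lemma discounted_value_fixpoint:
  "discounted_value G l w = l * mix (x l) (y l) (payoff G) w +
    (1 - l) * (\<Sum>w'\<in>UNIV. trans_prob G (x l) (y l) w w' * discounted_value G l w')"
proof -
  obtain u where u: "\<And>w. u w = l * mix (x l) (y l) (payoff G) w +
      (1 - l) * (\<Sum>w'\<in>UNIV. trans_prob G (x l) (y l) w w' * u w')"
    using ex_stationary_value[OF l] by metis
  have "u = discounted_value G l"
    using discounted_payoff_stationary[OF l u] discounted_payoff_optimal1 discounted_payoff_optimal2
    by (metis antisym ext)
  then show ?thesis using u by metis
qed

lemma discounted_value_bounded: "\<bar>discounted_value G l w\<bar> \<le> max_payoff G"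
proof -
  note maximum = discounted_maximum_principle[where Q = "trans_prob G (x l) (y l)",
        OF trans_prob_nonneg sum_trans_prob l]
  have "mix (x l) (y l) (payoff G) w \<le> mix (x l) (y l) (\<lambda>w i j. max_payoff G) w"
    and "mix (x l) (y l) (\<lambda>w i j. - max_payoff G) w \<le> mix (x l) (y l) (payoff G) w" for w
    using payoff_le[of G] by (auto intro!: mix_mono simp: abs_le_iff) (metis minus_le_iff)
  then have b: "mix (x l) (y l) (payoff G) w \<le> max_payoff G"
    "- mix (x l) (y l) (payoff G) w \<le> max_payoff G" for w
    by (simp_all add: mix_const minus_le_iff)
  have "discounted_value G l w \<le> max_payoff G"
  proof (rule maximum)
    fix w
    show "discounted_value G l w \<le> l * max_payoff G +
        (1 - l) * (\<Sum>w'\<in>UNIV. trans_prob G (x l) (y l) w w' * discounted_value G l w')"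
      using discounted_value_fixpoint[of w] mult_left_mono[OF b(1)[of w], of l] l by linarith
  qed
  moreover have "- discounted_value G l w \<le> max_payoff G"
  proof (rule maximum)
    fix w
    show "- discounted_value G l w \<le> l * max_payoff G +
        (1 - l) * (\<Sum>w'\<in>UNIV. trans_prob G (x l) (y l) w w' * - discounted_value G l w')"
      using discounted_value_fixpoint[of w] mult_left_mono[OF b(2)[of w], of l] l
      by (simp add: sum_negf) 
  qed
  ultimately show ?thesis by (simp add: abs_le_iff)
qed

text \<open>Player 2 deviates to the pure action \<open>j\<close> at \<open>w\<close> and keeps
  \<open>y l\<close> elsewhere. The payoff stays at least the value, and the defect in the Shapley
  equation is zero off \<open>w\<close>, so \<open>one_shot_deviation\<close> gives its sign at
  \<open>w\<close>.\<close>

lemma shapley_inequality1: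
  "(\<Sum>i\<in>UNIV. pmf (x l w) i *
    (l * payoff G w i j + (1 - l) * next_value G (discounted_value G l) w i j - discounted_value G l w)) \<ge> 0"
proof -
  let ?v = "discounted_value G l"
  define y' where "y' = (y l)(w := return_pmf j)"
  define D where "D = mix (x l) y' (\<lambda>w i j. l * payoff G w i j + (1 - l) * next_value G ?v w i j - ?v w)"
  obtain u where u: "\<And>w. u w = l * mix (x l) y' (payoff G) w +
      (1 - l) * (\<Sum>w'\<in>UNIV. trans_prob G (x l) y' w w' * u w')"
    using ex_stationary_value[OF l] by metis
  have "D w \<ge> 0"
  proof (rule one_shot_deviation[where Q = "trans_prob G (x l) y'" and e = "\<lambda>w. u w - ?v w",
        OF trans_prob_nonneg sum_trans_prob l])
    show "u w' - ?v w' = D w' + (1 - l) * (\<Sum>w''\<in>UNIV. trans_prob G (x l) y' w' w'' * (u w'' - ?v w''))" for w'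
      using u[of w'] unfolding D_def mix_deficit by (simp add: sum_subtractf right_diff_distrib)
    show "0 \<le> u w' - ?v w'" for w'
      using discounted_payoff_stationary[OF l u, of w'] discounted_payoff_optimal1[of w' "stationary y'"] by simp
    show "D w' = 0" if "w' \<noteq> w" for w'
    proof -
      have "D w' = mix (x l) (y l) (\<lambda>w i j. l * payoff G w i j + (1 - l) * next_value G ?v w i j - ?v w) w'"
        using that by (simp add: D_def mix_def y'_def)
      then show ?thesis using discounted_value_fixpoint[of w'] by (simp add: mix_deficit)
    qed
  qed
  moreover have "y' w = return_pmf j" by (simp add: y'_def)
  ultimately show ?thesis by (simp add: D_def mix_pure_right)
qed

text \<open>Mirror image: Player 1 deviates to \<open>i\<close> at \<open>w\<close>, and
  \<open>one_shot_deviation\<close> is applied to the negated defect.\<close>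

lemma shapley_inequality2:
  "(\<Sum>j\<in>UNIV. pmf (y l w) j *
    (l * payoff G w i j + (1 - l) * next_value G (discounted_value G l) w i j - discounted_value G l w)) \<le> 0"
proof -
  let ?v = "discounted_value G l"
  define x' where "x' = (x l)(w := return_pmf i)"
  define D where "D = mix x' (y l) (\<lambda>w i j. l * payoff G w i j + (1 - l) * next_value G ?v w i j - ?v w)"
  obtain u where u: "\<And>w. u w = l * mix x' (y l) (payoff G) w +
      (1 - l) * (\<Sum>w'\<in>UNIV. trans_prob G x' (y l) w w' * u w')"
    using ex_stationary_value[OF l] by metis
  have "- D w \<ge> 0"
  proof (rule one_shot_deviation[where Q = "trans_prob G x' (y l)" and e = "\<lambda>w. ?v w - u w"
        and D = "\<lambda>w. - D w", OF trans_prob_nonneg sum_trans_prob l])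
    show "?v w' - u w' = - D w' + (1 - l) * (\<Sum>w''\<in>UNIV. trans_prob G x' (y l) w' w'' * (?v w'' - u w''))" for w'
      using u[of w'] unfolding D_def mix_deficit by (simp add: sum_subtractf right_diff_distrib)
    show "0 \<le> ?v w' - u w'" for w'
      using discounted_payoff_stationary[OF l u, of w'] discounted_payoff_optimal2[of w' "stationary x'"] by simp
    show "- D w' = 0" if "w' \<noteq> w" for w'
    proof -
      have "D w' = mix (x l) (y l) (\<lambda>w i j. l * payoff G w i j + (1 - l) * next_value G ?v w i j - ?v w) w'"
        using that by (simp add: D_def mix_def x'_def)
      then show ?thesis using discounted_value_fixpoint[of w'] by (simp add: mix_deficit)
    qed
  qed
  moreover have "x' w = return_pmf i" by (simp add: x'_def)
  ultimately show ?thesis by (simp add: D_def mix_pure_left)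
qed

end

section \<open>Cramer determinants and the level sets of the values\<close>

lemma det_rows_sum_expand:
  fixes a :: "'w::finite \<Rightarrow> 'a::finite \<Rightarrow> real" and R :: "'w \<Rightarrow> 'a \<Rightarrow> 'w \<Rightarrow> real"
  shows "det (\<chi> w w'. \<Sum>i\<in>UNIV. a w i * R w i w') =
    (\<Sum>f\<in>UNIV. (\<Prod>w\<in>UNIV. a w (f w)) * det (\<chi> w w'. R w (f w) w'))"
proof -
  \<comment> \<open>In the Leibniz formula each product of row sums is expanded over all choice
    functions \<open>f\<close>, which are the pure stationary strategies.\<close>
  have "det (\<chi> w w'. \<Sum>i\<in>UNIV. a w i * R w i w') =
    (\<Sum>p | p permutes UNIV. of_int (sign p) * (\<Sum>f\<in>UNIV. \<Prod>w\<in>UNIV. a w (f w) * R w (f w) (p w)))"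
    by (simp add: det_def prod_sum_PiE PiE_UNIV_domain)
  also have "\<dots> = (\<Sum>p | p permutes UNIV. \<Sum>f\<in>UNIV.
      (\<Prod>w\<in>UNIV. a w (f w)) * (of_int (sign p) * (\<Prod>w\<in>UNIV. R w (f w) (p w))))"
    by (simp add: sum_distrib_left prod.distrib mult.left_commute)
  also have "\<dots> = (\<Sum>f\<in>UNIV. \<Sum>p | p permutes UNIV.
      (\<Prod>w\<in>UNIV. a w (f w)) * (of_int (sign p) * (\<Prod>w\<in>UNIV. R w (f w) (p w))))"
    by (rule sum.swap)
  finally show ?thesis by (simp add: det_def sum_distrib_left)
qed

text \<open>
  The entries of the resolvent matrix of a pure stationary profile in which, as in Cramer's rule,
  column \<open>k\<close> is replaced by the right-hand side, minus \<open>c\<close> times the old column \<open>k\<close>.  Row \<open>w\<close> depends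
  only on the actions at \<open>w\<close>, so that the determinant is multilinear in the mixed actions.
\<close>

definition cramer_entry ::
  "('w, 'i, 'j) stochastic_game \<Rightarrow> real \<Rightarrow> real \<Rightarrow> 'w \<Rightarrow> 'w \<Rightarrow> 'i \<Rightarrow> 'j \<Rightarrow> 'w \<Rightarrow> real" where
  "cramer_entry G l c k w i j w' =
    (if w' = k then l * payoff G w i j - c * (of_bool (w = k) - (1 - l) * pmf (transition G w i j) k)
     else of_bool (w = w') - (1 - l) * pmf (transition G w i j) w')"

definition cramer_det ::
  "('w::finite, 'i, 'j) stochastic_game \<Rightarrow> real \<Rightarrow> real \<Rightarrow> 'w \<Rightarrow> ('w \<Rightarrow> 'i) \<Rightarrow> ('w \<Rightarrow> 'j) \<Rightarrow> real" where
  "cramer_det G l c k f h = det (\<chi> w w'. cramer_entry G l c k w (f w) (h w) w')"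

lemma det_mix_cramer_entry:
  fixes G :: "('w::finite, 'i::finite, 'j::finite) stochastic_game"
  assumes u: "\<And>w. u w = l * mix x y (payoff G) w + (1 - l) * (\<Sum>w'\<in>UNIV. trans_prob G x y w w' * u w')"
  shows "det (\<chi> w w'. mix x y (\<lambda>w i j. cramer_entry G l c k w i j w') w) =
    (u k - c) * det (resolvent G l x y)"
proof -
  \<comment> \<open>\<open>u\<close> minus \<open>c\<close> times the unit vector at
    \<open>k\<close>. Column \<open>k\<close> of the averaged matrix is the resolvent matrix applied
    to \<open>z\<close>, so Cramer's rule yields \<open>z $ k = u k - c\<close> times the
    determinant.\<close>
  define z :: "real^'w" where "z = (\<chi> w. u w - c * of_bool (w = k))"
  have entry: "mix x y (\<lambda>w i j. cramer_entry G l c k w i j w') w =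
    (if w' = k then (resolvent G l x y *v z) $ w else resolvent G l x y $ w $ w')" for w w'
  proof (cases "w' = k")
    case True
    have "(\<Sum>w'\<in>UNIV. trans_prob G x y w w' * (c * of_bool (w' = k))) =
        (\<Sum>w'\<in>UNIV. if w' = k then c * trans_prob G x y w w' else 0)"
      by (intro sum.cong) auto
    then have T: "(\<Sum>w'\<in>UNIV. trans_prob G x y w w' * (u w' - c * of_bool (w' = k))) =
        (\<Sum>w'\<in>UNIV. trans_prob G x y w w' * u w') - c * trans_prob G x y w k"
      by (simp add: right_diff_distrib sum_subtractf)
    have "(resolvent G l x y *v z) $ w =
        l * mix x y (payoff G) w - c * (of_bool (w = k) - (1 - l) * trans_prob G x y w k)"
      unfolding resolvent_mult z_def vec_lambda_beta T using u[of w] by (simp add: algebra_simps)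
    then show ?thesis using True
      by (simp add: cramer_entry_def mix_diff mix_scale mix_const trans_prob_def)
  next
    case False
    then show ?thesis
      by (simp add: cramer_entry_def mix_diff mix_scale mix_const trans_prob_def resolvent_def)
  qed
  show ?thesis unfolding entry cramer_lemma by (simp add: z_def)
qed

text \<open>The weights are the probabilities of the pure strategies \<open>f\<close> when the
  actions at the different states are drawn independently from \<open>x\<close>; multilinearity
  moves the averaging into the rows.\<close>

lemma sum_cramer_det_left:
  fixes G :: "('w::finite, 'i::finite, 'j::finite) stochastic_game"
  shows "(\<Sum>f\<in>UNIV. (\<Prod>w\<in>UNIV. pmf (x w) (f w)) * cramer_det G l c k f h) =
    det (\<chi> w w'. mix x (\<lambda>w. return_pmf (h w)) (\<lambda>w i j. cramer_entry G l c k w i j w') w)"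
  unfolding cramer_det_def
  by (subst det_rows_sum_expand[where R = "\<lambda>w i w'. cramer_entry G l c k w i (h w) w'", symmetric])
    (simp add: mix_pure_right[where y = "\<lambda>w. return_pmf (h w)" and j = "h w" for w, OF refl])

lemma sum_cramer_det_right:
  fixes G :: "('w::finite, 'i::finite, 'j::finite) stochastic_game"
  shows "(\<Sum>h\<in>UNIV. (\<Prod>w\<in>UNIV. pmf (y w) (h w)) * cramer_det G l c k f h) =
    det (\<chi> w w'. mix (\<lambda>w. return_pmf (f w)) y (\<lambda>w i j. cramer_entry G l c k w i j w') w)"
  unfolding cramer_det_def
  by (subst det_rows_sum_expand[where R = "\<lambda>w j w'. cramer_entry G l c k w (f w) j w'", symmetric])
    (simp add: mix_pure_left[where x = "\<lambda>w. return_pmf (f w)" and i = "f w" for w, OF refl])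

lemma poly_det: "poly (det M) l = det (\<chi> w w'. poly (M $ w $ w') l)"
  for M :: "real poly^'w^'w::finite"
  by (simp add: det_def poly_sum poly_prod)

lemma degree_det_le:
  fixes M :: "real poly^'w^'w::finite"
  assumes "\<And>w w'. degree (M $ w $ w') \<le> 1"
  shows "degree (det M) \<le> CARD('w)"
  unfolding det_def
proof (rule degree_sum_le)
  fix p :: "'w \<Rightarrow> 'w"
  have "(\<Sum>w\<in>UNIV. degree (M $ w $ p w)) \<le> (\<Sum>w\<in>(UNIV :: 'w set). 1)"
    by (intro sum_mono assms)
  then have "degree (\<Prod>w\<in>UNIV. M $ w $ p w) \<le> CARD('w)"
    using degree_prod_sum_le[of "UNIV :: 'w set" "\<lambda>w. M $ w $ p w"] by (simp add: comp_def)
  then show "degree (of_int (sign p) * (\<Prod>w\<in>UNIV. M $ w $ p w)) \<le> CARD('w)"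
    by (cases "sign p = 1") (auto simp: sign_def split: if_splits)
qed (simp add: finite_permutations)

text \<open>\<open>cramer_det\<close> as a polynomial in the discount factor \<lambda>:
  \<open>[:1, -1:]\<close> stands for 1 - \<lambda>, and all entries have degree at most 1.\<close>

definition cramer_poly ::
  "('w::finite, 'i, 'j) stochastic_game \<Rightarrow> real \<Rightarrow> 'w \<Rightarrow> ('w \<Rightarrow> 'i) \<Rightarrow> ('w \<Rightarrow> 'j) \<Rightarrow> real poly" where
  "cramer_poly G c k f h = det (\<chi> w w'.
    if w' = k then [:0, payoff G w (f w) (h w):] - [:c:] * ([:of_bool (w = k):] - [:1, -1:] * [:pmf (transition G w (f w) (h w)) k:])
    else [:of_bool (w = w'):] - [:1, -1:] * [:pmf (transition G w (f w) (h w)) w':])"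

lemma poly_cramer_poly: "poly (cramer_poly G c k f h) l = cramer_det G l c k f h"
  unfolding cramer_poly_def cramer_det_def poly_det
  by (intro arg_cong[where f = det]) (simp add: vec_eq_iff cramer_entry_def algebra_simps)

lemma degree_cramer_poly:
  fixes G :: "('w::finite, 'i, 'j) stochastic_game"
  shows "degree (cramer_poly G c k f h) \<le> CARD('w)"
  unfolding cramer_poly_def
  by (rule degree_det_le) (auto intro!: degree_diff_le)

text \<open>The unit rows express that the unknowns are positive.\<close>

definition value_system ::
  "('w::finite, 'i, 'j) stochastic_game \<Rightarrow> real \<Rightarrow> 'w \<Rightarrow> (('w \<Rightarrow> 'i) \<Rightarrow> real poly) set" where
  "value_system G c k =
    range (\<lambda>f f'. of_bool (f' = f)) \<union> range (\<lambda>h f. cramer_poly G c k f h)"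

lemma feasible_value_system:
  fixes G :: "('w::finite, 'i::finite, 'j::finite) stochastic_game"
  shows "feasible UNIV (value_system G c k) l \<longleftrightarrow>
    (\<exists>X. (\<forall>f. X f > 0) \<and> (\<forall>h. (\<Sum>f\<in>UNIV. cramer_det G l c k f h * X f) > 0))"
proof -
  have "(\<Sum>f'\<in>UNIV. poly (of_bool (f' = f)) l * X f') = X f" for f and X :: "('w \<Rightarrow> 'i) \<Rightarrow> real"
    by (simp add: of_bool_def if_distrib if_distribR cong: if_cong)
  then show ?thesis
    by (simp add: feasible_def value_system_def ball_Un poly_cramer_poly)
qed

text \<open>Finitely many strict inequalities survive a small perturbation; this later turns
  nonnegative weights into positive ones.\<close>

lemma ex_pos_perturbation:
  fixes S T :: "'a::finite \<Rightarrow> real"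
  assumes "\<And>h. S h > 0"
  shows "\<exists>\<epsilon>>0. \<forall>h. S h + \<epsilon> * T h > 0"
proof -
  define \<epsilon> where "\<epsilon> = Min (range (\<lambda>h. S h / (\<bar>T h\<bar> + 1)))"
  have "\<epsilon> \<in> range (\<lambda>h. S h / (\<bar>T h\<bar> + 1))" unfolding \<epsilon>_def by (rule Min_in) auto
  then have "\<epsilon> > 0" using assms by (auto intro!: divide_pos_pos)
  moreover have "S h + \<epsilon> * T h > 0" for h
  proof -
    have "\<epsilon> \<le> S h / (\<bar>T h\<bar> + 1)" unfolding \<epsilon>_def by (rule Min_le) auto
    then have "\<epsilon> * \<bar>T h\<bar> + \<epsilon> \<le> S h" by (simp add: field_simps)
    moreover have "\<epsilon> * T h \<ge> - (\<epsilon> * \<bar>T h\<bar>)" using \<open>\<epsilon> > 0\<close> by (simp add: abs_if)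
    ultimately show ?thesis using \<open>\<epsilon> > 0\<close> by linarith
  qed
  ultimately show ?thesis by blast
qed

text \<open>The system asks for arbitrary positive weights on the pure strategies of Player 1, not
  for product weights, and is therefore linear. If the value exceeds \<open>c\<close>, perturbed
  product weights of \<open>x l\<close> solve it; otherwise product weights of \<open>y l\<close>
  refute any solution, as in weak duality for matrix games.\<close>

lemma discounted_value_gt_iff:
  fixes G :: "('w::finite, 'i::finite, 'j::finite) stochastic_game"
  assumes opt: "discounted_optimal_stationary_profile G x y" and l: "0 < l" "l \<le> 1"
  shows "discounted_value G l k > c \<longleftrightarrow> feasible UNIV (value_system G c k) l"
proof
  assume gt: "discounted_value G l k > c"
  define X where "X f = (\<Prod>w\<in>UNIV. pmf (x l w) (f w))" for f
  have X: "(\<Sum>f\<in>UNIV. cramer_det G l c k f h * X f) > 0" for h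
  proof -
    let ?y = "\<lambda>w. return_pmf (h w)"
    obtain u where u: "\<And>w. u w = l * mix (x l) ?y (payoff G) w +
        (1 - l) * (\<Sum>w'\<in>UNIV. trans_prob G (x l) ?y w w' * u w')"
      using ex_stationary_value[OF l] by metis
    have "u k \<ge> discounted_value G l k"
      using discounted_payoff_stationary[OF l u, of k]
        discounted_payoff_optimal1[OF opt l, of k "stationary ?y"] by simp
    then have "(u k - c) * det (resolvent G l (x l) ?y) > 0"
      using gt det_resolvent_pos[OF l] by (intro mult_pos_pos) auto
    also have "(u k - c) * det (resolvent G l (x l) ?y) = (\<Sum>f\<in>UNIV. X f * cramer_det G l c k f h)"
      unfolding X_def sum_cramer_det_left by (rule det_mix_cramer_entry[OF u, symmetric])
    finally show ?thesis by (simp add: mult.commute)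
  qed
  \<comment> \<open>\<open>X f\<close> may vanish, while the unit rows demand positivity, so a small
    constant is added.\<close>
  have "\<exists>\<epsilon>>0. \<forall>h. (\<Sum>f\<in>UNIV. cramer_det G l c k f h * X f) +
      \<epsilon> * (\<Sum>f\<in>UNIV. cramer_det G l c k f h) > 0"
    by (rule ex_pos_perturbation) (rule X)
  then obtain \<epsilon> where \<epsilon>: "\<epsilon> > 0" "\<And>h. (\<Sum>f\<in>UNIV. cramer_det G l c k f h * X f) +
      \<epsilon> * (\<Sum>f\<in>UNIV. cramer_det G l c k f h) > 0" by blast
  have "X f + \<epsilon> > 0" for f
    using \<epsilon>(1) by (intro add_nonneg_pos) (auto simp: X_def intro!: prod_nonneg)
  moreover have "(\<Sum>f\<in>UNIV. cramer_det G l c k f h * (X f + \<epsilon>)) > 0" for h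
    using \<epsilon>(2)[of h] by (simp add: algebra_simps sum.distrib sum_distrib_left)
  ultimately show "feasible UNIV (value_system G c k) l"
    unfolding feasible_value_system by (intro exI[of _ "\<lambda>f. X f + \<epsilon>"]) blast
next
  assume "feasible UNIV (value_system G c k) l"
  then obtain X where X: "\<And>f. X f > 0" "\<And>h. (\<Sum>f\<in>UNIV. cramer_det G l c k f h * X f) > 0"
    unfolding feasible_value_system by blast
  define Y where "Y h = (\<Prod>w\<in>UNIV. pmf (y l w) (h w))" for h
  have Y: "Y h \<ge> 0" for h by (auto simp: Y_def intro!: prod_nonneg)
  have "\<exists>j. pmf (y l w) j > 0" for w
    using set_pmf_not_empty[of "y l w"] pmf_positive by fastforce
  then obtain h0 where "\<And>w. pmf (y l w) (h0 w) > 0" by metis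
  then have h0: "Y h0 > 0" by (auto simp: Y_def intro!: prod_pos)
  show "discounted_value G l k > c"
  proof (rule ccontr)
    assume "\<not> ?thesis"
    then have le: "discounted_value G l k \<le> c" by simp
    have neg: "(\<Sum>h\<in>UNIV. Y h * cramer_det G l c k f h) \<le> 0" for f
    proof -
      let ?x = "\<lambda>w. return_pmf (f w)"
      obtain u where u: "\<And>w. u w = l * mix ?x (y l) (payoff G) w +
          (1 - l) * (\<Sum>w'\<in>UNIV. trans_prob G ?x (y l) w w' * u w')"
        using ex_stationary_value[OF l] by metis
      have "u k \<le> discounted_value G l k"
        using discounted_payoff_stationary[OF l u, of k]
          discounted_payoff_optimal2[OF opt l, of k "stationary ?x"] by simp
      then have "(u k - c) * det (resolvent G l ?x (y l)) \<le> 0"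
        using le det_resolvent_pos[OF l, of G ?x "y l"] by (intro mult_nonpos_nonneg) auto
      also have "(u k - c) * det (resolvent G l ?x (y l)) = (\<Sum>h\<in>UNIV. Y h * cramer_det G l c k f h)"
        unfolding Y_def sum_cramer_det_right by (rule det_mix_cramer_entry[OF u, symmetric])
      finally show ?thesis .
    qed
    \<comment> \<open>The determinants weighted by \<open>Y h * X f\<close> are summed in both
      orders: positive by the rows of the system, nonpositive by optimality of
      \<open>y l\<close>.\<close>
    have "0 < (\<Sum>h\<in>UNIV. Y h * (\<Sum>f\<in>UNIV. cramer_det G l c k f h * X f))"
      using X(2) Y h0 by (intro sum_pos2[of _ h0] mult_pos_pos mult_nonneg_nonneg) (auto intro: less_imp_le)
    also have "\<dots> = (\<Sum>h\<in>UNIV. \<Sum>f\<in>UNIV. X f * (Y h * cramer_det G l c k f h))"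
      by (simp add: sum_distrib_left mult.left_commute mult.commute)
    also have "\<dots> = (\<Sum>f\<in>UNIV. \<Sum>h\<in>UNIV. X f * (Y h * cramer_det G l c k f h))"
      by (rule sum.swap)
    also have "\<dots> = (\<Sum>f\<in>UNIV. X f * (\<Sum>h\<in>UNIV. Y h * cramer_det G l c k f h))"
      by (simp add: sum_distrib_left)
    also have "\<dots> \<le> 0"
      by (rule sum_nonpos) (rule mult_nonneg_nonpos[OF less_imp_le[OF X(1)] neg])
    finally show False by simp
  qed
qed

text \<open>The number of rows and the degrees are bounded through the numbers of pure stationary
  strategies and of states, so one \<open>N\<close> serves all levels and initial states.\<close>

lemma discounted_value_switches:
  fixes G :: "('w::finite, 'i::finite, 'j::finite) stochastic_game"
  assumes opt: "discounted_optimal_stationary_profile G x y"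
  shows "\<exists>N. \<forall>c k. switches_at_most N {0<..1} (\<lambda>l. discounted_value G l k > c)"
proof -
  let ?m = "CARD('w \<Rightarrow> 'i) + CARD('w \<Rightarrow> 'j)"
  obtain N where N: "\<And>S :: (('w \<Rightarrow> 'i) \<Rightarrow> real poly) set. finite S \<Longrightarrow> card S \<le> ?m \<Longrightarrow>
      (\<forall>r\<in>S. \<forall>v\<in>UNIV. degree (r v) \<le> CARD('w)) \<Longrightarrow> switches_at_most N UNIV (feasible UNIV S)"
    using feasible_switches[of "UNIV :: ('w \<Rightarrow> 'i) set" ?m "CARD('w)"] by auto
  have "switches_at_most N {0<..1} (\<lambda>l. discounted_value G l k > c)" for c k
  proof -
    have "switches_at_most N UNIV (feasible UNIV (value_system G c k))"
    proof (rule N)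
      show "finite (value_system G c k)" by (simp add: value_system_def)
      show "card (value_system G c k) \<le> ?m"
        unfolding value_system_def
        by (intro order.trans[OF card_Un_le] add_mono card_image_le) simp_all
      show "\<forall>r\<in>value_system G c k. \<forall>v\<in>UNIV. degree (r v) \<le> CARD('w)"
        by (auto simp: value_system_def degree_cramer_poly)
    qed
    then obtain F where "finite F" "card F \<le> N" and F: "\<And>a b. a \<le> b \<Longrightarrow> {a..b} \<inter> F = {} \<Longrightarrow>
        feasible UNIV (value_system G c k) a = feasible UNIV (value_system G c k) b"
      by (rule switches_at_mostE) simp
    then show ?thesis
      unfolding switches_at_most_def
      by (intro exI[of _ F]) (simp add: discounted_value_gt_iff[OF opt])
  qed
  then show ?thesis by blast
qed

subsection \<open>Block strategies\<close>

lemma sum_inverse_sqrt_le: "(\<Sum>i=1..n. 1 / sqrt (real i)) \<le> 2 * sqrt (real n)"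
proof (induction n)
  case (Suc n)
  have "1 / sqrt (real (Suc n)) \<le> 2 * (sqrt (real (Suc n)) - sqrt (real n))"
  proof -
    let ?s = "sqrt (real (Suc n))" and ?r = "sqrt (real n)"
    have "?s > 0" "?r \<le> ?s" "?r \<ge> 0" by simp_all
    have "1 = (?s - ?r) * (?s + ?r)" by (simp add: algebra_simps)
    also have "\<dots> \<le> (?s - ?r) * (2 * ?s)" using \<open>?r \<le> ?s\<close> by (intro mult_left_mono) auto
    finally show ?thesis using \<open>?s > 0\<close> by (simp add: field_simps)
  qed
  then show ?case using Suc by simp
qed simp

lemma sum_inverse_block_le:
  fixes a n :: nat
  assumes "a > 0"
  shows "real a * (\<Sum>t<n. 1 / (real n - real (t div a) * real a)) \<le> 2 * sqrt (real a * real n) + real a"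
proof -
  let ?L = "\<lambda>t. real n - real (t div a) * real a"
  let ?q = "n div a * a"
  have q: "?q \<le> n" "real n - real (n div a) * real a = real (n mod a)"
    by (simp_all, metis add_diff_cancel_left' div_mult_mod_eq of_nat_add of_nat_mult)
  \<comment> \<open>In a full block \<open>?L t\<close> is at least \<open>a\<close> and at least
    \<open>n - t\<close>, hence at least their geometric mean.\<close>
  have early: "1 / ?L t \<le> 1 / sqrt a * (1 / sqrt (real (n - t)))" if "t < ?q" for t
  proof -
    have "t div a < n div a" using that \<open>a > 0\<close> by (metis div_less_iff_less_mult)
    then have "(t div a + 1) * a \<le> ?q" by (intro mult_right_mono) auto
    then have "(t div a + 1) * a \<le> n" using q(1) by (rule le_trans)
    then have "(t div a) * a + a \<le> n" by (simp add: add.commute)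
    then have La: "?L t \<ge> real a"
      by (metis add.commute le_diff_eq of_nat_add of_nat_le_iff of_nat_mult)
    have "real (t div a) * real a \<le> real t"
      unfolding of_nat_mult[symmetric] of_nat_le_iff by simp
    moreover have "t < n" by (rule less_le_trans[OF that q(1)])
    ultimately have Lt: "?L t \<ge> real (n - t)" by (simp add: of_nat_diff)
    have pos: "real (n - t) > 0" using less_le_trans[OF that q(1)] by simp
    have "sqrt a * sqrt (real (n - t)) \<le> sqrt (?L t) * sqrt (?L t)"
      using La Lt by (intro mult_mono real_sqrt_le_mono) auto
    also have "\<dots> = ?L t" using La by simp
    finally have "1 / ?L t \<le> 1 / (sqrt a * sqrt (real (n - t)))"
      using \<open>a > 0\<close> pos less_le_trans[OF _ La, of 0]
      by (intro divide_left_mono mult_pos_pos) simp_all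
    then show ?thesis by simp
  qed
  \<comment> \<open>The last, incomplete block has \<open>n mod a\<close> stages with this summand
    and contributes at most 1.\<close>
  have late: "1 / ?L t = 1 / real (n mod a)" if "t \<in> {?q..<n}" for t
  proof -
    have "t div a = n div a"
      using that div_le_mono[of "?q" t a] div_le_mono[of t n a] \<open>a > 0\<close> by simp
    then show ?thesis using q by simp
  qed
  have "(\<Sum>t<n. 1 / ?L t) = (\<Sum>t<?q. 1 / ?L t) + (\<Sum>t\<in>{?q..<n}. 1 / ?L t)"
    using sum.atLeastLessThan_concat[of 0 ?q n "\<lambda>t. 1 / ?L t"] q(1) by (simp add: atLeast0LessThan)
  also have "(\<Sum>t\<in>{?q..<n}. 1 / ?L t) = (\<Sum>t\<in>{?q..<n}. 1 / real (n mod a))"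
    by (rule sum.cong[OF refl late])
  also have "\<dots> \<le> 1"
    using q(1) by (simp add: minus_div_mult_eq_mod)
  also have "(\<Sum>t<?q. 1 / ?L t) \<le> (\<Sum>t<?q. 1 / sqrt a * (1 / sqrt (real (n - t))))"
    by (intro sum_mono early) simp
  also have "\<dots> \<le> (\<Sum>t<n. 1 / sqrt a * (1 / sqrt (real (n - t))))"
    using q(1) by (intro sum_mono2) auto
  also have "\<dots> = 1 / sqrt a * (\<Sum>i=1..n. 1 / sqrt (real i))"
    unfolding sum_distrib_left[symmetric]
    by (intro arg_cong[where f = "(*) _"] sum.reindex_bij_witness[of _ "\<lambda>i. n - i" "\<lambda>t. n - t"]) auto
  also have "\<dots> \<le> 1 / sqrt a * (2 * sqrt (real n))"
    by (intro mult_left_mono sum_inverse_sqrt_le) auto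
  finally have "real a * (\<Sum>t<n. 1 / ?L t) \<le> real a * (1 / sqrt a * (2 * sqrt (real n)) + 1)"
    by (intro mult_left_mono) auto
  also have "\<dots> = 2 * sqrt (real a * real n) + real a"
    using \<open>a > 0\<close> by (simp add: field_simps real_sqrt_mult)
  finally show ?thesis .
qed

text \<open>Here \<open>t\<close> counts stages from 0, \<open>L k\<close> is the reciprocal
  discount factor of block \<open>k\<close>, and \<open>A k t\<close> plays the expected
  block-\<open>k\<close> value at time \<open>t\<close>. The potential \<open>(n - t) * A\<close>
  telescopes; \<open>L\<close> exceeds \<open>n - t\<close> by the position inside the block, and
  this excess is traded for a second telescoping sum at the cost of the last error term.\<close>

lemma block_sum_ge:
  fixes n a :: nat and g d :: "nat \<Rightarrow> real" and A :: "nat \<Rightarrow> nat \<Rightarrow> real"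
  defines "L \<equiv> \<lambda>k. real n - real k * real a" and "K \<equiv> (n - 1) div a"
  assumes a: "a > 0"
    and g: "\<And>t. t < n \<Longrightarrow> \<bar>g t\<bar> \<le> C"
    and A: "\<And>k t. k \<le> K \<Longrightarrow> \<bar>A k t\<bar> \<le> C"
    and jump: "\<And>k t. k < K \<Longrightarrow> \<bar>A k t - A (Suc k) t\<bar> \<le> d k"
    and step: "\<And>t. t < n \<Longrightarrow>
      g t + (L (t div a) - 1) * A (t div a) (Suc t) \<ge> L (t div a) * A (t div a) t"
  shows "(\<Sum>t<n. g t) \<ge> real n * A 0 0 - ((\<Sum>k<K. L (Suc k) * d k) + real a * (2 * C + (\<Sum>k<K. d k))
    + 4 * C * (real a * (\<Sum>t<n. 1 / L (t div a))))"
proof (cases "n = 0")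
  case True
  have "C \<ge> 0" using A[of 0 0] by linarith
  then show ?thesis using True by (simp add: K_def)
next
  case False
  \<comment> \<open>Among times up to \<open>n\<close>, the cap at \<open>K\<close> matters only for
    \<open>t = n\<close>, which would open a new block when \<open>a\<close> divides
    \<open>n\<close>.\<close>
  define \<kappa> where "\<kappa> t = min (t div a) K" for t
  define S where "S t = A (\<kappa> t) t" for t
  \<comment> \<open>\<open>J\<close> collects the cost of changing the value function at the last stage of each block.\<close>
  define B where "B t = (real n - real t) * S t" for t
  define J where "J t = (\<Sum>k<K. if t = Suc k * a - 1 then d k else 0)" for t
  have \<kappa>: "\<kappa> t = t div a" if "t < n" for t
    using that div_le_mono[of t "n - 1" a] by (simp add: \<kappa>_def K_def)
  have \<kappa>K: "\<kappa> t \<le> K" for t by (simp add: \<kappa>_def)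
  have S: "\<bar>S t\<bar> \<le> C" for t unfolding S_def by (rule A[OF \<kappa>K])
  have C: "C \<ge> 0" using S[of 0] by linarith
  have d: "d k \<ge> 0" if "k < K" for k using jump[OF that, of 0] by linarith
  have J0: "J t \<ge> 0" for t unfolding J_def by (intro sum_nonneg) (auto intro: d)
  \<comment> \<open>The block index changes only when \<open>a\<close> divides \<open>Suc t\<close>,
    and then \<open>d (\<kappa> t)\<close> is a summand of \<open>J t\<close>.\<close>
  have J: "\<bar>A (\<kappa> t) (Suc t) - S (Suc t)\<bar> \<le> J t" if "t < n" for t
  proof (cases "\<kappa> (Suc t) = \<kappa> t")
    case True
    then show ?thesis using J0 by (simp add: S_def)
  next
    case False
    then have ne: "min (Suc t div a) K \<noteq> t div a" using \<kappa>[OF that] by (simp add: \<kappa>_def)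
    have le: "t div a \<le> K" using \<kappa>K[of t] \<kappa>[OF that] by simp
    have suc: "Suc t div a = (if Suc t mod a = 0 then Suc (t div a) else t div a)"
      by (rule div_Suc)
    then have m: "Suc t mod a = 0" using ne le by (auto split: if_splits)
    then have k: "\<kappa> t < K" "\<kappa> (Suc t) = Suc (\<kappa> t)"
      using ne le suc \<kappa>[OF that] by (auto simp: \<kappa>_def)
    have "Suc t = Suc (t div a) * a" using m suc by (metis add.right_neutral div_mult_mod_eq)
    then have t: "t = Suc (\<kappa> t) * a - 1" using \<kappa>[OF that] by simp
    have "d (\<kappa> t) = (\<Sum>k\<in>{\<kappa> t}. if t = Suc k * a - 1 then d k else 0)" using t by simp
    also have "\<dots> \<le> J t" unfolding J_def using k(1) d by (intro sum_mono2) auto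
    finally show ?thesis using jump[OF k(1), of "Suc t"] k(2) by (simp add: S_def)
  qed
  have stage: "g t \<ge> B t - B (Suc t) - (real n - real (Suc t)) * J t - real a * (S (Suc t) - S t)
      - real a * J t - 4 * C * (real a * (1 / L (t div a)))" if t: "t < n" for t
  proof -
    let ?k = "t div a"
    define l where "l = L ?k"
    define X where "X = A ?k (Suc t)"
    \<comment> \<open>The position of \<open>t\<close> inside its block, which is the excess of
      \<open>l\<close> over the weight \<open>n - t\<close> in \<open>B\<close>.\<close>
    define \<tau> where "\<tau> = real t - real ?k * real a"
    have \<tau>: "\<tau> = real (t mod a)"
      by (simp add: \<tau>_def flip: of_nat_mult minus_div_mult_eq_mod)
    then have \<tau>b: "0 \<le> \<tau>" "\<tau> \<le> real a" using a by (simp_all add: less_imp_le)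
    have l: "l = real n - real t + \<tau>" by (simp add: l_def L_def \<tau>_def)
    have l1: "l \<ge> 1" using t \<tau>b by (simp add: l)
    have St: "S t = A ?k t" by (simp add: S_def \<kappa>[OF t])
    have X: "\<bar>X - S (Suc t)\<bar> \<le> J t" using J[OF t] by (simp add: X_def \<kappa>[OF t])
    have XC: "\<bar>X\<bar> \<le> C" unfolding X_def \<kappa>[OF t, symmetric] by (rule A[OF \<kappa>K])
    have st: "g t \<ge> l * S t - (l - 1) * X" using step[OF t] unfolding X_def l_def St by linarith
    \<comment> \<open>Expected values almost increase: \<open>X - S t \<ge> - 4 * C / l\<close>.
      Since \<open>D \<ge> 0\<close>, its factor \<open>\<tau>\<close> may be raised to the constant
      \<open>a\<close>, and the differences then telescope up to block changes.\<close>
    define D where "D = X - S t + 4 * C / l"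
    have "D \<ge> 0"
    \<comment> \<open>For \<open>l \<ge> 2\<close> the one-stage inequality is divided by
      \<open>l - 1 \<ge> l / 2\<close>; for smaller \<open>l\<close> the slack is at least the
      trivial bound \<open>2 * C\<close>.\<close>
    proof (cases "l \<ge> 2")
      case True
      have "(l - 1) * (X - S t) \<ge> - 2 * C"
        using st g[OF t] S[of t] by (simp add: algebra_simps abs_le_iff) 
      then have "X - S t \<ge> - 2 * C / (l - 1)" using True by (simp add: field_simps)
      moreover have "2 * C / (l - 1) \<le> 4 * C / l"
        using True C mult_left_mono[of 2 l C] by (simp add: field_simps)
      ultimately show ?thesis by (simp add: D_def)
    next
      case False
      have "4 * C / l \<ge> 2 * C" using False l1 C mult_left_mono[of l 2 C] by (simp add: field_simps)
      then show ?thesis using XC S[of t] by (simp add: D_def abs_le_iff)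
    qed
    then have "\<tau> * D \<le> real a * D" using \<tau>b by (intro mult_right_mono)
    moreover have "\<tau> * (4 * C / l) \<ge> 0" using \<tau>b C l1 by simp
    moreover have "\<tau> * (X - S t) = \<tau> * D - \<tau> * (4 * C / l)" by (simp add: D_def algebra_simps)
    ultimately have 1: "\<tau> * (X - S t) \<le> real a * D" by linarith
    have "X - S t \<le> S (Suc t) - S t + J t" using X by linarith
    then have "real a * D \<le> real a * (S (Suc t) - S t + J t + 4 * C / l)"
      unfolding D_def by (intro mult_left_mono) auto
    with 1 have 2: "\<tau> * (X - S t) \<le> real a * (S (Suc t) - S t + J t + 4 * C / l)" by linarith
    have "(real n - real (Suc t)) * X \<le> (real n - real (Suc t)) * (S (Suc t) + J t)"
      using X t by (intro mult_left_mono) auto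
    moreover have "l * S t - (l - 1) * X = (real n - real t) * S t - (real n - real (Suc t)) * X - \<tau> * (X - S t)"
      by (simp add: l algebra_simps)
    ultimately have "g t \<ge> (real n - real t) * S t - (real n - real (Suc t)) * (S (Suc t) + J t)
        - real a * (S (Suc t) - S t + J t + 4 * C / l)"
      using st 2 by linarith
    then show ?thesis by (simp add: B_def l_def algebra_simps)
  qed
  have pick: "(\<Sum>t<n. c t * J t) = (\<Sum>k<K. c (Suc k * a - 1) * d k)" for c
  proof -
    have "(\<Sum>t<n. c t * J t) = (\<Sum>k<K. \<Sum>t<n. if t = Suc k * a - 1 then c t * d k else 0)"
      unfolding J_def sum_distrib_left by (subst sum.swap) (intro sum.cong refl, simp)
    also have "\<dots> = (\<Sum>k<K. c (Suc k * a - 1) * d k)"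
    proof (intro sum.cong refl)
      fix k assume "k \<in> {..<K}"
      then have "Suc k * a \<le> K * a" by (intro mult_right_mono) auto
      also have "\<dots> \<le> n - 1" by (simp add: K_def)
      finally have "Suc k * a - 1 < n" using False by linarith
      then show "(\<Sum>t<n. if t = Suc k * a - 1 then c t * d k else 0) = c (Suc k * a - 1) * d k"
        by (simp add: sum.delta)
    qed
    finally show ?thesis .
  qed
  have "(\<Sum>t<n. g t) \<ge> (\<Sum>t<n. B t - B (Suc t) - (real n - real (Suc t)) * J t
      - real a * (S (Suc t) - S t) - real a * J t - 4 * C * (real a * (1 / L (t div a))))"
    by (intro sum_mono stage) simp
  also have "(\<Sum>t<n. B t - B (Suc t) - (real n - real (Suc t)) * J t
      - real a * (S (Suc t) - S t) - real a * J t - 4 * C * (real a * (1 / L (t div a)))) =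
    (\<Sum>t<n. B t - B (Suc t)) - (\<Sum>t<n. (real n - real (Suc t)) * J t)
      - real a * (\<Sum>t<n. S (Suc t) - S t) - (\<Sum>t<n. real a * J t)
      - 4 * C * (real a * (\<Sum>t<n. 1 / L (t div a)))"
    by (simp add: sum_subtractf sum_distrib_left right_diff_distrib)
  \<comment> \<open>The boundary term \<open>B n\<close> vanishes because its weight is
    \<open>n - n\<close>.\<close>
  also have "(\<Sum>t<n. B t - B (Suc t)) = real n * A 0 0"
    unfolding sum_lessThan_telescope' by (simp add: B_def S_def \<kappa>_def)
  also have "(\<Sum>t<n. S (Suc t) - S t) = S n - S 0" by (rule sum_lessThan_telescope)
  \<comment> \<open>At the last stage \<open>t = Suc k * a - 1\<close> of block \<open>k\<close> the
    weight \<open>n - Suc t\<close> equals \<open>L (Suc k)\<close>.\<close>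
  also have "(\<Sum>t<n. (real n - real (Suc t)) * J t) = (\<Sum>k<K. L (Suc k) * d k)"
    unfolding pick using a by (intro sum.cong refl) (simp add: L_def Suc_diff_Suc algebra_simps)
  also have "(\<Sum>t<n. real a * J t) = real a * (\<Sum>k<K. d k)"
    unfolding pick by (simp add: sum_distrib_left)
  finally have "(\<Sum>t<n. g t) \<ge> real n * A 0 0 - (\<Sum>k<K. L (Suc k) * d k) - real a * (S n - S 0)
      - real a * (\<Sum>k<K. d k) - 4 * C * (real a * (\<Sum>t<n. 1 / L (t div a)))" .
  moreover have "real a * (S n - S 0) \<le> real a * (2 * C)"
    using S[of n] S[of 0] by (intro mult_left_mono) auto
  ultimately show ?thesis by (simp add: algebra_simps)
qed

section \<open>Variation of the discounted values along the blocks\<close>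

lemma block_discount_mem:
  assumes "n > 0" "a > 0" "k \<le> (n - 1) div a"
  shows "real n - real k * real a \<ge> 1" "block_discount a n k \<in> {0<..1}"
proof -
  have "k * a \<le> (n - 1) div a * a" using assms(3) by (rule mult_right_mono) simp
  also have "\<dots> \<le> n - 1" by simp
  finally have "k * a + 1 \<le> n" using assms(1) by linarith
  then show 1: "real n - real k * real a \<ge> 1"
    by (simp flip: of_nat_mult)
  then show "block_discount a n k \<in> {0<..1}" by (simp add: block_discount_def)
qed

lemma block_discount_mono:
  assumes "n > 0" "a > 0" "j \<le> k" "k \<le> (n - 1) div a"
  shows "block_discount a n j \<le> block_discount a n k"
proof -
  have "real j * real a \<le> real k * real a" using assms by (intro mult_right_mono) auto
  then show ?thesis
    unfolding block_discount_def
    using block_discount_mem(1)[OF assms(1,2,4)]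
    by (intro divide_left_mono mult_pos_pos) auto
qed

lemma block_discount_strict_mono:
  assumes "n > 0" "a > 0" "k < (n - 1) div a"
  shows "block_discount a n k < block_discount a n (Suc k)"
  unfolding block_discount_def
  using block_discount_mem(1)[OF assms(1,2), of k] block_discount_mem(1)[OF assms(1,2), of "Suc k"] assms
  by (intro divide_strict_left_mono mult_pos_pos) (auto simp: algebra_simps)

context
  fixes f :: "real \<Rightarrow> real" and N :: nat and C :: real
  assumes f: "\<And>c. switches_at_most N {0<..1} (\<lambda>l. f l > c)"
    and bound: "\<And>l. l \<in> {0<..1} \<Longrightarrow> \<bar>f l\<bar> \<le> C"
begin

lemma block_variation_le_range:
  fixes n a :: nat
  assumes n: "n > 0" and a: "a > 0" and S: "S \<subseteq> {..<(n - 1) div a}" and "lo \<le> hi"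
    and range: "\<And>k. k \<in> S \<Longrightarrow> f (block_discount a n k) \<in> {lo..hi}"
      "\<And>k. k \<in> S \<Longrightarrow> f (block_discount a n (Suc k)) \<in> {lo..hi}"
  shows "(\<Sum>k\<in>S. \<bar>f (block_discount a n (Suc k)) - f (block_discount a n k)\<bar>) \<le> 2 * real N * (hi - lo)"
proof (rule sum_abs_diff_le[where D = "{0<..1}" and f = f and \<mu> = "block_discount a n"])
  show "finite S" using S by (rule finite_subset) simp
  show "block_discount a n k \<in> {0<..1} \<and> block_discount a n (Suc k) \<in> {0<..1}" if "k \<in> S" for k
    using that S by (intro conjI block_discount_mem n a) auto
  show "block_discount a n k < block_discount a n (Suc k)" if "k \<in> S" for k
    using that S by (intro block_discount_strict_mono n a) auto
  show "block_discount a n (Suc j) \<le> block_discount a n k" if "j \<in> S" "k \<in> S" "j < k" for j k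
    using that S by (intro block_discount_mono n a) auto
  show "switches_at_most N {0<..1} (\<lambda>l. f l > c)" for c by (rule f)
qed (use range \<open>lo \<le> hi\<close> in auto)

lemma block_variation_le:
  fixes n a :: nat
  assumes n: "n > 0" and a: "a > 0"
  shows "(\<Sum>k<(n - 1) div a. \<bar>f (block_discount a n (Suc k)) - f (block_discount a n k)\<bar>) \<le> 4 * real N * C"
proof -
  have "C \<ge> 0" using bound[of 1] by simp
  have mem: "f (block_discount a n k) \<in> {- C..C}" if "k \<le> (n - 1) div a" for k
    using bound[OF block_discount_mem(2)[OF n a that]] by auto
  show ?thesis
    using block_variation_le_range[OF n a subset_refl, of "- C" C] mem \<open>C \<ge> 0\<close> by simp
qed

text \<open>The weight is the reciprocal of the next discount factor. While that factor is at most
  \<open>\<delta>\<close>, \<open>f\<close> stays in a narrow window, so a small variation meets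
  weights at most \<open>n\<close>; afterwards the weights are at most \<open>1 / \<delta>\<close>
  and the total variation is bounded. \<open>R\<close> is uniform in \<open>n\<close> and
  \<open>a\<close>.\<close>

lemma weighted_block_variation_le:
  assumes "\<eta> > 0"
  shows "\<exists>R. \<forall>n>0. \<forall>a>0. (\<Sum>k<(n - 1) div a. (real n - real (Suc k) * real a) *
    \<bar>f (block_discount a n (Suc k)) - f (block_discount a n k)\<bar>) \<le> real n * \<eta> + R"
proof -
  \<comment> \<open>Makes the variation bound \<open>2 * N * \<eta>'\<close> in the window at most
    \<open>\<eta>\<close>; the summand 1 covers \<open>N = 0\<close>.\<close>
  define \<eta>' where "\<eta>' = \<eta> / (2 * real N + 1)"
  have \<eta>': "\<eta>' > 0" "2 * real N * \<eta>' \<le> \<eta>"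
    using assms by (auto simp: \<eta>'_def field_simps)
  obtain \<delta> lo where \<delta>: "0 < \<delta>" "\<delta> \<le> 1" "\<forall>l\<in>{0<..\<delta>}. f l \<in> {lo..lo + \<eta>'}"
    using switches_convergent[OF f bound \<eta>'(1)] by blast
  show ?thesis
  proof (intro exI allI impI)
    fix n a :: nat assume n: "n > 0" and a: "a > 0"
    define K where "K = (n - 1) div a"
    define V where "V k = \<bar>f (block_discount a n (Suc k)) - f (block_discount a n k)\<bar>" for k
    define S where "S = {k. k < K \<and> block_discount a n (Suc k) \<le> \<delta>}"
    have S: "S \<subseteq> {..<K}" by (auto simp: S_def)
    have mem: "f (block_discount a n j) \<in> {lo..lo + \<eta>'}"
      if "k \<in> S" "j \<le> Suc k" for j k
    proof -
      have k: "Suc k \<le> (n - 1) div a" using that by (simp add: S_def K_def)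
      have "block_discount a n j \<le> \<delta>"
        using block_discount_mono[OF n a that(2) k] that(1) by (simp add: S_def)
      moreover have "block_discount a n j > 0"
        using block_discount_mem(2)[OF n a, of j] k that(2) by simp
      ultimately show ?thesis using \<delta>(3) by simp
    qed
    have "(\<Sum>k\<in>S. V k) \<le> 2 * real N * (lo + \<eta>' - lo)"
      unfolding V_def using \<eta>'(1) S mem
      by (intro block_variation_le_range n a) (auto simp: K_def)
    then have VS: "(\<Sum>k\<in>S. V k) \<le> \<eta>" using \<eta>'(2) by simp
    have "(\<Sum>k<K. (real n - real (Suc k) * real a) * V k) \<le>
        (\<Sum>k<K. (if k \<in> S then real n * V k else 0) + 1 / \<delta> * V k)"
    proof (intro sum_mono)
      fix k assume "k \<in> {..<K}"
      then have k: "Suc k \<le> (n - 1) div a" by (simp add: K_def)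
      show "(real n - real (Suc k) * real a) * V k \<le> (if k \<in> S then real n * V k else 0) + 1 / \<delta> * V k"
      proof (cases "k \<in> S")
        case True
        have "(real n - real (Suc k) * real a) * V k \<le> real n * V k"
          by (intro mult_right_mono) (auto simp: V_def)
        moreover have "1 / \<delta> * V k \<ge> 0" using \<delta>(1) by (simp add: V_def)
        ultimately show ?thesis using True by simp
      next
        case False
        then have "\<delta> < 1 / (real n - real (Suc k) * real a)"
          using \<open>k \<in> {..<K}\<close> by (simp add: S_def block_discount_def)
        then have "real n - real (Suc k) * real a \<le> 1 / \<delta>"
          using block_discount_mem(1)[OF n a k] \<delta>(1) by (simp add: field_simps)
        then have "(real n - real (Suc k) * real a) * V k \<le> 1 / \<delta> * V k"
          by (intro mult_right_mono) (auto simp: V_def)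
        then show ?thesis using False by simp
      qed
    qed
    also have "\<dots> = (\<Sum>k<K. if k \<in> S then real n * V k else 0) + 1 / \<delta> * (\<Sum>k<K. V k)"
      by (simp add: sum.distrib sum_distrib_left)
    also have "(\<Sum>k<K. if k \<in> S then real n * V k else 0) = real n * (\<Sum>k\<in>S. V k)"
      using S by (simp add: sum.If_cases sum_distrib_left Int_absorb1)
    also have "\<dots> + 1 / \<delta> * (\<Sum>k<K. V k) \<le> real n * \<eta> + 1 / \<delta> * (4 * real N * C)"
      using VS block_variation_le[OF n a] \<delta>(1)
      by (intro add_mono mult_left_mono) (auto simp: V_def K_def)
    finally show "(\<Sum>k<(n - 1) div a. (real n - real (Suc k) * real a) *
        \<bar>f (block_discount a n (Suc k)) - f (block_discount a n k)\<bar>)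
        \<le> real n * \<eta> + 1 / \<delta> * (4 * real N * C)"
      by (simp add: V_def K_def)
  qed
qed

end

text \<open>A sum over states, dominating the supremum norm of the change, so that scalar variation
  bounds apply state by state.\<close>

definition value_jump :: "('w::finite, 'i, 'j) stochastic_game \<Rightarrow> nat \<Rightarrow> nat \<Rightarrow> nat \<Rightarrow> real" where
  "value_jump G a n k = (\<Sum>w\<in>UNIV. \<bar>discounted_value G (block_discount a n (Suc k)) w
    - discounted_value G (block_discount a n k) w\<bar>)"

text \<open>The loss in \<open>block_sum_ge\<close> for \<open>C = max_payoff G\<close> and
  \<open>d = value_jump G a n\<close>, with its last sum bounded by
  \<open>sum_inverse_block_le\<close>.\<close>

definition block_error :: "('w::finite, 'i, 'j) stochastic_game \<Rightarrow> nat \<Rightarrow> nat \<Rightarrow> real" where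
  "block_error G a n =
    (\<Sum>k<(n - 1) div a. (real n - real (Suc k) * real a) * value_jump G a n k)
    + real a * (2 * max_payoff G + (\<Sum>k<(n - 1) div a. value_jump G a n k))
    + 4 * max_payoff G * (2 * sqrt (real a * real n) + real a)"

text \<open>After division by \<open>n\<close>, the first summand is small by the weighted variation
  bound, the second is \<open>a n / n\<close> times a bounded factor, and the third is controlled by
  \<open>sqrt (a n / n)\<close> and \<open>a n / n\<close>.\<close>

lemma block_error_sublinear:
  fixes G :: "('w::finite, 'i::finite, 'j::finite) stochastic_game"
  assumes opt: "discounted_optimal_stationary_profile G x y"
    and a: "\<And>n. n \<ge> 1 \<Longrightarrow> a n > 0" and lim: "(\<lambda>n. real (a n) / real n) \<longlonglongrightarrow> 0"
  shows "(\<lambda>n. block_error G (a n) n / real n) \<longlonglongrightarrow> 0"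
proof -
  obtain N where N: "\<And>c k. switches_at_most N {0<..1} (\<lambda>l. discounted_value G l k > c)"
    using discounted_value_switches[OF opt] by blast
  have bound: "\<bar>discounted_value G l w\<bar> \<le> max_payoff G" if "l \<in> {0<..1}" for l w
    using discounted_value_bounded[OF opt] that by simp
  define M where "M = max_payoff G"
  define V where "V = real CARD('w) * (4 * real N * M)"
  define W where "W n = (\<Sum>k<(n - 1) div a n. (real n - real (Suc k) * real (a n)) * value_jump G (a n) n k)" for n
  define T where "T n = (\<Sum>k<(n - 1) div a n. value_jump G (a n) n k)" for n
  have T: "0 \<le> T n" "T n \<le> V" if "n \<ge> 1" for n
  proof -
    show "0 \<le> T n" by (auto simp: T_def value_jump_def intro!: sum_nonneg)
    have "T n = (\<Sum>w\<in>UNIV. \<Sum>k<(n - 1) div a n. \<bar>discounted_value G (block_discount (a n) n (Suc k)) w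
        - discounted_value G (block_discount (a n) n k) w\<bar>)"
      unfolding T_def value_jump_def by (rule sum.swap)
    also have "\<dots> \<le> (\<Sum>w\<in>(UNIV :: 'w set). 4 * real N * M)"
      unfolding M_def using that a by (intro sum_mono block_variation_le N bound) auto
    finally show "T n \<le> V" by (simp add: V_def)
  qed
  have Wlim: "(\<lambda>n. W n / real n) \<longlonglongrightarrow> 0"
  proof (rule LIMSEQ_I)
    fix r :: real assume "r > 0"
    \<comment> \<open>One half of \<open>r\<close> is shared among the states; the other half
      absorbs the constants \<open>R w\<close> once \<open>n \<ge> n0\<close>.\<close>
    define \<eta> where "\<eta> = r / (2 * real CARD('w))"
    have "\<eta> > 0" using \<open>r > 0\<close> by (simp add: \<eta>_def)
    have "\<forall>w. \<exists>R. \<forall>n>0. \<forall>b>0. (\<Sum>k<(n - 1) div b. (real n - real (Suc k) * real b) *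
      \<bar>discounted_value G (block_discount b n (Suc k)) w - discounted_value G (block_discount b n k) w\<bar>)
      \<le> real n * \<eta> + R"
      by (intro allI weighted_block_variation_le[OF N bound \<open>\<eta> > 0\<close>])
    then obtain R where R: "\<And>w n b. n > 0 \<Longrightarrow> b > 0 \<Longrightarrow>
      (\<Sum>k<(n - 1) div b. (real n - real (Suc k) * real b) *
      \<bar>discounted_value G (block_discount b n (Suc k)) w - discounted_value G (block_discount b n k) w\<bar>)
      \<le> real n * \<eta> + R w"
      unfolding choice_iff by blast
    define R' where "R' = (\<Sum>w\<in>UNIV. \<bar>R w\<bar>)"
    obtain n0 where n0: "real n0 > 2 * R' / r" using reals_Archimedean2 by blast
    show "\<exists>no. \<forall>n\<ge>no. norm (W n / real n - 0) < r"
    proof (intro exI[of _ "max n0 1"] allI impI)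
      fix n assume "n \<ge> max n0 1"
      then have n: "n \<ge> 1" "n \<ge> n0" by auto
      have "W n = (\<Sum>w\<in>UNIV. \<Sum>k<(n - 1) div a n. (real n - real (Suc k) * real (a n)) *
        \<bar>discounted_value G (block_discount (a n) n (Suc k)) w - discounted_value G (block_discount (a n) n k) w\<bar>)"
        unfolding W_def value_jump_def sum_distrib_left by (rule sum.swap)
      also have "\<dots> \<le> (\<Sum>w\<in>UNIV. real n * \<eta> + \<bar>R w\<bar>)"
        using n a by (intro sum_mono order.trans[OF R]) auto
      also have "\<dots> = real n * (r / 2) + R'"
        by (simp add: sum.distrib R'_def \<eta>_def)
      also have "R' < real n * (r / 2)"
        using n0 n(2) \<open>r > 0\<close> by (simp add: field_simps) (smt (verit) mult_left_mono of_nat_mono)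
      finally have "W n < real n * r" by (simp add: mult.commute)
      moreover have "W n \<ge> 0"
        unfolding W_def value_jump_def
      proof (intro sum_nonneg mult_nonneg_nonneg)
        fix k assume "k \<in> {..<(n - 1) div a n}"
        then have "real n - real (Suc k) * real (a n) \<ge> 1"
          using n a by (intro block_discount_mem(1)) auto
        then show "real n - real (Suc k) * real (a n) \<ge> 0" by linarith
      qed simp
      ultimately show "norm (W n / real n - 0) < r" using n by (simp add: pos_divide_less_eq mult.commute)
    qed
  qed
  have Tlim: "(\<lambda>n. real (a n) / real n * (2 * M + T n)) \<longlonglongrightarrow> 0"
  proof (rule Lim_null_comparison)
    show "\<forall>\<^sub>F n in sequentially. norm (real (a n) / real n * (2 * M + T n)) \<le> real (a n) / real n * \<bar>2 * M + V\<bar>"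
    proof (rule eventually_sequentiallyI[of 1])
      fix n :: nat assume n: "1 \<le> n"
      have "M \<ge> 0" using bound[of 1] by (auto simp: M_def intro: order.trans[OF abs_ge_zero])
      then have "\<bar>2 * M + T n\<bar> \<le> \<bar>2 * M + V\<bar>" using T[OF n] by linarith
      then show "norm (real (a n) / real n * (2 * M + T n)) \<le> real (a n) / real n * \<bar>2 * M + V\<bar>"
        by (simp add: abs_mult mult_left_mono divide_right_mono)
    qed
    show "(\<lambda>n. real (a n) / real n * \<bar>2 * M + V\<bar>) \<longlonglongrightarrow> 0"
      using tendsto_mult_right[OF lim, of "\<bar>2 * M + V\<bar>"] by (simp add: mult.commute tendsto_mult_left_zero lim)
  qed
  have "(\<lambda>n. W n / real n + real (a n) / real n * (2 * M + T n)
      + 4 * M * (2 * sqrt (real (a n) / real n) + real (a n) / real n)) \<longlonglongrightarrow> 0 + 0 + 4 * M * (2 * sqrt 0 + 0)"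
    by (intro tendsto_intros Wlim Tlim lim)
  moreover have "\<forall>\<^sub>F n in sequentially. W n / real n + real (a n) / real n * (2 * M + T n)
      + 4 * M * (2 * sqrt (real (a n) / real n) + real (a n) / real n) = block_error G (a n) n / real n"
  proof (rule eventually_sequentiallyI[of 1])
    fix n :: nat assume n: "1 \<le> n"
    have "real (a n) * real n = real (a n) / real n * (real n)\<^sup>2"
      using n by (simp add: power2_eq_square)
    then have sqrt: "sqrt (real (a n) * real n) = sqrt (real (a n) / real n) * real n"
      by (simp only: real_sqrt_mult real_sqrt_abs abs_of_nat)
    have "w / m + b / m * c + 4 * M * (2 * s + b / m) = (w + b * c + 4 * M * (2 * (s * m) + b)) / m"
      if "m \<noteq> 0" for w m b c s :: real using that by (simp add: field_simps)
    then show "W n / real n + real (a n) / real n * (2 * M + T n)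
      + 4 * M * (2 * sqrt (real (a n) / real n) + real (a n) / real n) = block_error G (a n) n / real n"
      unfolding block_error_def W_def[symmetric] T_def[symmetric] M_def[symmetric] sqrt
      using n by simp
  qed
  ultimately show ?thesis using tendsto_cong by force
qed

section \<open>Guarantees in the n-stage game\<close>

lemma nstage_payoff_eq:
  fixes G :: "('w::finite, 'i::finite, 'j::finite) stochastic_game"
  shows "nstage_payoff G n \<omega> \<sigma> \<rho> =
    (\<Sum>t<n. \<integral>p. stage_reward G (p t) \<partial>play_measure G \<omega> \<sigma> \<rho>) / real n"
proof -
  have "(\<Sum>m = 1..n. stage_payoff G m p) = (\<Sum>t<n. stage_reward G (p t))" for p
    by (rule sum.reindex_bij_witness[of _ Suc "\<lambda>m. m - 1"]) (auto simp: stage_payoff_def stage_reward_def)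
  then show ?thesis
    using integrable_play[of G \<omega> \<sigma> \<rho> "stage_reward G"]
    by (simp add: nstage_payoff_def Bochner_Integration.integral_sum)
qed

lemma nstage_payoff_bounded:
  fixes G :: "('w::finite, 'i::finite, 'j::finite) stochastic_game"
  assumes "n > 0"
  shows "\<bar>nstage_payoff G n \<omega> \<sigma> \<rho>\<bar> \<le> max_payoff G"
proof -
  have "\<bar>\<Sum>t<n. \<integral>p. stage_reward G (p t) \<partial>play_measure G \<omega> \<sigma> \<rho>\<bar> \<le> (\<Sum>t<n. max_payoff G)"
    by (intro order.trans[OF sum_abs] sum_mono integral_play_bounded stage_reward_le)
  then show ?thesis using assms by (simp add: nstage_payoff_eq field_simps abs_divide)
qed

context
  fixes G :: "('w::finite, 'i::finite, 'j::finite) stochastic_game"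
    and x :: "real \<Rightarrow> 'w \<Rightarrow> 'i pmf" and y :: "real \<Rightarrow> 'w \<Rightarrow> 'j pmf"
  assumes opt: "discounted_optimal_stationary_profile G x y"
begin

text \<open>The Shapley inequality holds against each pure action, hence also on average over the
  mixed action \<open>\<rho> h w\<close> that an arbitrary opponent uses after
  \<open>h\<close>.\<close>

lemma stage_inequality1:
  assumes l: "l \<in> {0<..1}" and \<sigma>: "\<And>h w. length h = t \<Longrightarrow> \<sigma> h w = x l w"
  shows "l * (\<integral>p. stage_reward G (p t) \<partial>play_measure G \<omega> \<sigma> \<rho>)
    + (1 - l) * (\<integral>p. discounted_value G l (fst (p (Suc t))) \<partial>play_measure G \<omega> \<sigma> \<rho>)
    \<ge> (\<integral>p. discounted_value G l (fst (p t)) \<partial>play_measure G \<omega> \<sigma> \<rho>)"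
proof -
  let ?e = "\<lambda>w i j. l * payoff G w i j + (1 - l) * next_value G (discounted_value G l) w i j - discounted_value G l w"
  have "(\<integral>p. (case p t of (w, i, j) \<Rightarrow> ?e w i j) \<partial>play_measure G \<omega> \<sigma> \<rho>) \<ge> 0"
  proof (rule integral_play_nonneg[where \<phi> = "\<lambda>(w, i, j). ?e w i j"])
    fix h :: "('w \<times> 'i \<times> 'j) list" and w assume h: "length h = t"
    have "(\<Sum>i\<in>UNIV. \<Sum>j\<in>UNIV. pmf (\<sigma> h w) i * pmf (\<rho> h w) j * ?e w i j) =
        (\<Sum>j\<in>UNIV. \<Sum>i\<in>UNIV. pmf (\<rho> h w) j * (pmf (x l w) i * ?e w i j))"
      unfolding \<sigma>[OF h] by (subst sum.swap) (simp only: mult.left_commute mult.commute mult.assoc)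
    also have "\<dots> = (\<Sum>j\<in>UNIV. pmf (\<rho> h w) j * (\<Sum>i\<in>UNIV. pmf (x l w) i * ?e w i j))"
      by (simp only: sum_distrib_left)
    also have "\<dots> \<ge> 0"
      using l by (intro sum_nonneg mult_nonneg_nonneg shapley_inequality1[OF opt]) auto
    finally show "0 \<le> (\<Sum>i\<in>UNIV. \<Sum>j\<in>UNIV. pmf (\<sigma> h w) i * pmf (\<rho> h w) j *
        (case (w, i, j) of (w, i, j) \<Rightarrow> ?e w i j))" by (simp only: prod.case)
  qed
  then show ?thesis unfolding integral_stage_deficit by linarith
qed

lemma stage_inequality2:
  assumes l: "l \<in> {0<..1}" and \<rho>: "\<And>h w. length h = t \<Longrightarrow> \<rho> h w = y l w"
  shows "l * (\<integral>p. stage_reward G (p t) \<partial>play_measure G \<omega> \<sigma> \<rho>)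
    + (1 - l) * (\<integral>p. discounted_value G l (fst (p (Suc t))) \<partial>play_measure G \<omega> \<sigma> \<rho>)
    \<le> (\<integral>p. discounted_value G l (fst (p t)) \<partial>play_measure G \<omega> \<sigma> \<rho>)"
proof -
  let ?e = "\<lambda>w i j. l * payoff G w i j + (1 - l) * next_value G (discounted_value G l) w i j - discounted_value G l w"
  have "(\<integral>p. - (case p t of (w, i, j) \<Rightarrow> ?e w i j) \<partial>play_measure G \<omega> \<sigma> \<rho>) \<ge> 0"
  proof (rule integral_play_nonneg[where \<phi> = "\<lambda>z. - (case z of (w, i, j) \<Rightarrow> ?e w i j)"])
    fix h :: "('w \<times> 'i \<times> 'j) list" and w assume h: "length h = t"
    have "(\<Sum>i\<in>UNIV. \<Sum>j\<in>UNIV. pmf (\<sigma> h w) i * pmf (\<rho> h w) j * - ?e w i j) =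
        (\<Sum>i\<in>UNIV. pmf (\<sigma> h w) i * - (\<Sum>j\<in>UNIV. pmf (y l w) j * ?e w i j))"
      unfolding \<rho>[OF h] by (simp only: sum_distrib_left sum_negf mult_minus_right mult.assoc)
    also have "\<dots> \<ge> 0"
    proof (intro sum_nonneg mult_nonneg_nonneg)
      show "0 \<le> - (\<Sum>j\<in>UNIV. pmf (y l w) j * ?e w i j)" for i
        using shapley_inequality2[OF opt, of l w i] l by simp
    qed simp
    finally show "0 \<le> (\<Sum>i\<in>UNIV. \<Sum>j\<in>UNIV. pmf (\<sigma> h w) i * pmf (\<rho> h w) j *
        - (case (w, i, j) of (w, i, j) \<Rightarrow> ?e w i j))" by (simp only: prod.case)
  qed
  then have "(\<integral>p. (case p t of (w, i, j) \<Rightarrow> ?e w i j) \<partial>play_measure G \<omega> \<sigma> \<rho>) \<le> 0"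
    by simp
  then show ?thesis unfolding integral_stage_deficit by linarith
qed

text \<open>The sign \<open>s\<close> treats both players at once: \<open>s = 1\<close> for the
  guarantee of Player 1, \<open>s = - 1\<close> for that of Player 2 with all quantities
  negated.\<close>

lemma block_sum_ge_value:
  fixes \<omega> \<sigma> \<rho> and n a :: nat and s :: real
  assumes n: "n > 0" and a: "a > 0" and s: "\<bar>s\<bar> = 1"
    and ineq: "\<And>t. t < n \<Longrightarrow> let l = block_discount a n (t div a) in
      s * (l * (\<integral>p. stage_reward G (p t) \<partial>play_measure G \<omega> \<sigma> \<rho>)
      + (1 - l) * (\<integral>p. discounted_value G l (fst (p (Suc t))) \<partial>play_measure G \<omega> \<sigma> \<rho>))
      \<ge> s * (\<integral>p. discounted_value G l (fst (p t)) \<partial>play_measure G \<omega> \<sigma> \<rho>)"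
  shows "s * nstage_payoff G n \<omega> \<sigma> \<rho> \<ge> s * discounted_value G (1 / real n) \<omega> - block_error G a n / real n"
proof -
  let ?P = "play_measure G \<omega> \<sigma> \<rho>"
  interpret prob_space ?P by (rule prob_space_play_measure)
  let ?K = "(n - 1) div a" and ?M = "max_payoff G"
  let ?L = "\<lambda>k. real n - real k * real a"
  define v where "v k = discounted_value G (block_discount a n k)" for k
  define g where "g t = s * (\<integral>p. stage_reward G (p t) \<partial>?P)" for t
  define A where "A k t = s * (\<integral>p. v k (fst (p t)) \<partial>?P)" for k t
  have M: "?M \<ge> 0" using stage_reward_le[of G undefined] by linarith
  have vb: "\<bar>v k w\<bar> \<le> ?M" if "k \<le> ?K" for k w
    using discounted_value_bounded[OF opt] block_discount_mem(2)[OF n a that] by (simp add: v_def)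
  have "(\<Sum>t<n. g t) \<ge> real n * A 0 0 - ((\<Sum>k<?K. ?L (Suc k) * value_jump G a n k)
    + real a * (2 * ?M + (\<Sum>k<?K. value_jump G a n k))
    + 4 * ?M * (real a * (\<Sum>t<n. 1 / ?L (t div a))))"
  proof (rule block_sum_ge[OF a, where g = g and A = A])
    show "\<bar>g t\<bar> \<le> ?M" for t
      using integral_play_bounded[of "stage_reward G", OF stage_reward_le] s by (simp add: g_def abs_mult)
    show "\<bar>A k t\<bar> \<le> ?M" if "k \<le> ?K" for k t
      using integral_play_bounded[of "\<lambda>z. v k (fst z)", OF vb[OF that]] s by (simp add: A_def abs_mult)
    show "\<bar>A k t - A (Suc k) t\<bar> \<le> value_jump G a n k" if "k < ?K" for k t
    proof -
      have "\<bar>v k w - v (Suc k) w\<bar> \<le> value_jump G a n k" for w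
        unfolding value_jump_def v_def
        by (subst abs_minus_commute, rule member_le_sum[of w UNIV]) auto
      then have "\<bar>\<integral>p. v k (fst (p t)) - v (Suc k) (fst (p t)) \<partial>?P\<bar> \<le> value_jump G a n k"
        by (intro integral_play_bounded[of "\<lambda>z. v k (fst z) - v (Suc k) (fst z)"])
      moreover have "A k t - A (Suc k) t = s * (\<integral>p. v k (fst (p t)) - v (Suc k) (fst (p t)) \<partial>?P)"
        using integrable_play[of G \<omega> \<sigma> \<rho> "\<lambda>z. v k (fst z)" t]
          integrable_play[of G \<omega> \<sigma> \<rho> "\<lambda>z. v (Suc k) (fst z)" t]
        by (simp add: A_def right_diff_distrib)
      ultimately show ?thesis using s by (simp add: abs_mult)
    qed
    show "?L (t div a) * A (t div a) t \<le> g t + (?L (t div a) - 1) * A (t div a) (Suc t)" if t: "t < n" for t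
    proof -
      define l where "l = block_discount a n (t div a)"
      have k: "t div a \<le> ?K" using t by (intro div_le_mono) simp
      \<comment> \<open>Multiplying by the reciprocal of the discount factor brings the inequality
        into the normalization of \<open>block_sum_ge\<close>.\<close>
      have L: "?L (t div a) > 0" "?L (t div a) * l = 1"
        using block_discount_mem(1)[OF n a k] by (auto simp: l_def block_discount_def)
      have "l * g t + (1 - l) * A (t div a) (Suc t) \<ge> A (t div a) t"
        using ineq[OF t] by (simp add: Let_def g_def A_def v_def l_def algebra_simps)
      then have "?L (t div a) * A (t div a) t \<le> ?L (t div a) * (l * g t + (1 - l) * A (t div a) (Suc t))"
        using L(1) by (intro mult_left_mono) auto
      also have "\<dots> = (?L (t div a) * l) * g t + (?L (t div a) - ?L (t div a) * l) * A (t div a) (Suc t)"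
        by (simp only: algebra_simps)
      finally show ?thesis unfolding L(2) by simp
    qed
  qed
  moreover have "4 * ?M * (real a * (\<Sum>t<n. 1 / ?L (t div a))) \<le> 4 * ?M * (2 * sqrt (real a * real n) + real a)"
    using M by (intro mult_left_mono sum_inverse_block_le[OF a]) auto
  ultimately have "(\<Sum>t<n. g t) \<ge> real n * A 0 0 - block_error G a n"
    unfolding block_error_def by linarith
  \<comment> \<open>Block 0 has discount factor \<open>1 / n\<close>, and the play starts at
    \<open>\<omega>\<close>.\<close>
  moreover have "A 0 0 = s * discounted_value G (1 / real n) \<omega>"
    unfolding A_def integral_initial_state by (simp add: v_def block_discount_def)
  moreover have "(\<Sum>t<n. g t) = real n * (s * nstage_payoff G n \<omega> \<sigma> \<rho>)"
    using n unfolding nstage_payoff_eq g_def sum_distrib_left[symmetric] by simp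
  ultimately have "real n * (s * nstage_payoff G n \<omega> \<sigma> \<rho>) \<ge>
      real n * (s * discounted_value G (1 / real n) \<omega> - block_error G a n / real n)"
    using n by (simp add: right_diff_distrib)
  then show ?thesis using n by simp
qed

lemma nstage_payoff_ge:
  assumes "n > 0" "a > 0"
    and \<sigma>: "\<And>h w. length h < n \<Longrightarrow> \<sigma> h w = x (block_discount a n (length h div a)) w"
  shows "nstage_payoff G n \<omega> \<sigma> \<rho> \<ge> discounted_value G (1 / real n) \<omega> - block_error G a n / real n"
proof -
  have "1 * nstage_payoff G n \<omega> \<sigma> \<rho> \<ge> 1 * discounted_value G (1 / real n) \<omega> - block_error G a n / real n"
  proof (rule block_sum_ge_value[OF assms(1,2)])
    fix t assume t: "t < n"
    then have "t div a \<le> (n - 1) div a" by (intro div_le_mono) simp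
    then have "block_discount a n (t div a) \<in> {0<..1}"
      by (rule block_discount_mem(2)[OF assms(1,2)])
    from stage_inequality1[OF this, of t \<sigma> \<omega> \<rho>]
    show "let l = block_discount a n (t div a) in
      1 * (l * (\<integral>p. stage_reward G (p t) \<partial>play_measure G \<omega> \<sigma> \<rho>)
      + (1 - l) * (\<integral>p. discounted_value G l (fst (p (Suc t))) \<partial>play_measure G \<omega> \<sigma> \<rho>))
      \<ge> 1 * (\<integral>p. discounted_value G l (fst (p t)) \<partial>play_measure G \<omega> \<sigma> \<rho>)"
      using \<sigma> t by (simp add: Let_def)
  qed simp
  then show ?thesis by simp
qed

lemma nstage_payoff_le:
  assumes "n > 0" "a > 0"
    and \<rho>: "\<And>h w. length h < n \<Longrightarrow> \<rho> h w = y (block_discount a n (length h div a)) w"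
  shows "nstage_payoff G n \<omega> \<sigma> \<rho> \<le> discounted_value G (1 / real n) \<omega> + block_error G a n / real n"
proof -
  have "- 1 * nstage_payoff G n \<omega> \<sigma> \<rho> \<ge> - 1 * discounted_value G (1 / real n) \<omega> - block_error G a n / real n"
  proof (rule block_sum_ge_value[OF assms(1,2)])
    fix t assume t: "t < n"
    then have "t div a \<le> (n - 1) div a" by (intro div_le_mono) simp
    then have "block_discount a n (t div a) \<in> {0<..1}"
      by (rule block_discount_mem(2)[OF assms(1,2)])
    from stage_inequality2[OF this, of t \<rho> \<omega> \<sigma>]
    show "let l = block_discount a n (t div a) in
      - 1 * (l * (\<integral>p. stage_reward G (p t) \<partial>play_measure G \<omega> \<sigma> \<rho>)
      + (1 - l) * (\<integral>p. discounted_value G l (fst (p (Suc t))) \<partial>play_measure G \<omega> \<sigma> \<rho>))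
      \<ge> - 1 * (\<integral>p. discounted_value G l (fst (p t)) \<partial>play_measure G \<omega> \<sigma> \<rho>)"
      using \<rho> t by (simp add: Let_def)
  qed simp
  then show ?thesis by simp
qed

end

text \<open>One good strategy for each player encloses the max-min value; boundedness of the payoff
  makes the real \<open>SUP\<close> and \<open>INF\<close> meaningful.\<close>

lemma nstage_value_between:
  fixes G :: "('w::finite, 'i::finite, 'j::finite) stochastic_game"
  assumes n: "n > 0" and lower: "\<And>\<rho>. nstage_payoff G n \<omega> \<sigma>0 \<rho> \<ge> b"
    and upper: "\<And>\<sigma>. nstage_payoff G n \<omega> \<sigma> \<rho>0 \<le> c"
  shows "b \<le> nstage_value G n \<omega>" "nstage_value G n \<omega> \<le> c"
proof -
  have bdd: "bdd_below (range (\<lambda>\<rho>. nstage_payoff G n \<omega> \<sigma> \<rho>))" for \<sigma>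
    using nstage_payoff_bounded[OF n, of G \<omega> \<sigma>]
    by (intro bdd_belowI2[of _ "- max_payoff G"]) (simp add: abs_le_iff minus_le_iff)
  have inf: "(INF \<rho>. nstage_payoff G n \<omega> \<sigma> \<rho>) \<le> c" for \<sigma>
    using upper[of \<sigma>] by (intro cINF_lower2[OF bdd]) auto
  then show "nstage_value G n \<omega> \<le> c"
    unfolding nstage_value_def by (intro cSUP_least) auto
  have "b \<le> (INF \<rho>. nstage_payoff G n \<omega> \<sigma>0 \<rho>)"
    using lower by (intro cINF_greatest) auto
  also have "\<dots> \<le> nstage_value G n \<omega>"
    unfolding nstage_value_def using inf by (intro cSUP_upper bdd_aboveI2) auto
  finally show "b \<le> nstage_value G n \<omega>" .
qed

theorem theorem1p6:
  fixes G :: "('w::finite, 'i::finite, 'j::finite) stochastic_game"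
    and \<sigma> :: "nat \<Rightarrow> ('w, 'i, 'j) strategy1"
    and \<rho> :: "nat \<Rightarrow> ('w, 'i, 'j) strategy2"
  assumes "adapted_profile G \<sigma> \<rho>"
  shows "\<exists>\<epsilon> :: nat \<Rightarrow> real. \<epsilon> \<longlonglongrightarrow> 0 \<and>
    (\<forall>n\<ge>1. nstage_eps_optimal1 G n (\<epsilon> n) (\<sigma> n) \<and> nstage_eps_optimal2 G n (\<epsilon> n) (\<rho> n))"
proof -
  obtain x y and a :: "nat \<Rightarrow> nat" where opt: "discounted_optimal_stationary_profile G x y"
    and a: "\<forall>n\<ge>1. a n > 0" and lim: "(\<lambda>n. real (a n) / real n) \<longlonglongrightarrow> 0"
    and ad: "\<forall>n\<ge>1. \<forall>m\<in>{1..n}. \<forall>h w. length h = m - 1 \<longrightarrow>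
         \<sigma> n h w = x (block_discount (a n) n ((m - 1) div a n)) w \<and>
         \<rho> n h w = y (block_discount (a n) n ((m - 1) div a n)) w"
    using assms unfolding adapted_profile_def by (elim exE conjE) (rule that)
  define e where "e n = block_error G (a n) n / real n" for n
  have e: "e \<longlonglongrightarrow> 0"
    unfolding e_def using a by (intro block_error_sublinear[OF opt _ lim]) auto
  \<comment> \<open>A history of length \<open>m - 1\<close> belongs to stage \<open>m\<close>, so
    its block index is \<open>length h div a n\<close>.\<close>
  have play: "\<sigma> n h w = x (block_discount (a n) n (length h div a n)) w"
    "\<rho> n h w = y (block_discount (a n) n (length h div a n)) w"
    if "n \<ge> 1" "length h < n" for n h w
    using ad[rule_format, of n "Suc (length h)" h w] that by auto
  have ge: "nstage_payoff G n \<omega> (\<sigma> n) \<rho>' \<ge> discounted_value G (1 / real n) \<omega> - e n" if "n \<ge> 1" for n \<omega> \<rho>'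
    unfolding e_def using that a play by (intro nstage_payoff_ge[OF opt]) auto
  have le: "nstage_payoff G n \<omega> \<sigma>' (\<rho> n) \<le> discounted_value G (1 / real n) \<omega> + e n" if "n \<ge> 1" for n \<omega> \<sigma>'
    unfolding e_def using that a play by (intro nstage_payoff_le[OF opt]) auto
  show ?thesis
  \<comment> \<open>Each guarantee misses the discounted value at \<open>1 / n\<close> by at most
    \<open>e n\<close>, and \<open>nstage_value\<close> is within \<open>e n\<close> of it, so the
    errors add up to \<open>2 * e n\<close>.\<close>
  proof (intro exI[of _ "\<lambda>n. 2 * e n"] conjI allI impI)
    show "(\<lambda>n. 2 * e n) \<longlonglongrightarrow> 0" using tendsto_mult_right_zero[OF e] .
    fix n :: nat assume n: "n \<ge> 1"
    have val: "discounted_value G (1 / real n) \<omega> - e n \<le> nstage_value G n \<omega>"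
      "nstage_value G n \<omega> \<le> discounted_value G (1 / real n) \<omega> + e n" for \<omega>
      using n by (intro nstage_value_between[OF _ ge[OF n] le[OF n]]; simp)+
    show "nstage_eps_optimal1 G n (2 * e n) (\<sigma> n)"
      unfolding nstage_eps_optimal1_def using ge[OF n] val(2) by (smt (verit))
    show "nstage_eps_optimal2 G n (2 * e n) (\<rho> n)"
      unfolding nstage_eps_optimal2_def using le[OF n] val(1) by (smt (verit))
  qed
qed

end
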